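(* Let $\mathcal{C}$ be a combinatorial class whose generating series $C(x)=\sum_{k\ge1}c_kx^k$, $c_k=|\mathcal{C}_k|$, is subexponential with radius of convergence $\rho$, and let $m=\min\{k\in\mathbb{N}:c_k>0\}$. Let $\mathsf{G}_{n,N}$ be drawn uniformly at random from the set $\mathcal{G}_{n,N}$ of $\mathcal{C}$-multisets of size $n$ with $N$ components, and let $\mathcal{R}(\mathsf{G}_{n,N})$ be the remainder obtained by removing all components of size $m$ and one component of largest size. Then, as $n,N,n-mN\to\infty$, in distribution $$\mathcal{R}(\mathsf{G}_{n,N})\to\Gamma G_{>m}(\rho),$$ where $\Gamma G_{>m}(\rho)$ is the random multiset with values in $\mathcal{G}_{>m}$ given by $$\Pr[\Gamma G_{>m}(\rho)=G]=\exp\Big(-\sum_{j\ge1}\frac{C(\rho^j)-c_m\rho^{jm}}{j\rho^{jm}}\Big)\rho^{|G|-m\kappa(G)},\qquad G\in\mathcal{G}_{>m}.$$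
   Context: $\mathbb{N}=\{1,2,\dots\}$. A combinatorial class $\mathcal{C}$ is a countable set with a size function $|\cdot|:\mathcal{C}\to\mathbb{N}$ such that $\mathcal{C}_n=\{C\in\mathcal{C}:|C|=n\}$ is finite for all $n\in\mathbb{N}$. A $\mathcal{C}$-multiset is a finite set (possibly empty) $G=\{(C_1,d_1),\dots,(C_k,d_k)\}$ with pairwise distinct $C_i\in\mathcal{C}$ and multiplicities $d_i\in\mathbb{N}$. Its size is $|G|=\sum_id_i|C_i|$ and its number of components is $\kappa(G)=\sum_id_i$. $\mathcal{G}_{n,N}$ is the (finite) set of $\mathcal{C}$-multisets $G$ with $|G|=n$, $\kappa(G)=N$. $\mathcal{G}_{>m}$ is the (countable) set of all $\mathcal{C}$-multisets, including the empty one, all of whose elements $C_i$ satisfy $|C_i|>m$. Remainder: for a multiset $G$, $\mathcal{R}(G)$ is obtained by removing from $G$ all pairs $(C,d)$ with $|C|=m$ and removing one object of largest size (chosen in a canonical way according to a fixed numbering of $\mathcal{C}$): if this object has multiplicity $d>1$, $d$ is replaced by $d-1$, otherwise the object together with its multiplicity is deleted. With $c_0=0$, the series $C(x)$ is called subexponential with radius of convergence $\rho>0$ if $c_n>0$ for all large $n$ and, as $n\to\infty$, $c_{n-1}/c_n\to\rho$ and $c_n^{-1}\sum_{1\le k\le n}c_kc_{n-k}\to2C(\rho)<\infty$ (for integer coefficients, as here, necessarily $\rho<1$). Limits "as $n,N,n-mN\to\infty$" are along arbitrary sequences of pairs $(n,N)\in\mathbb{N}^2$ with $n\to\infty$, $N\to\infty$,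 $n-mN\to\infty$. Convergence in distribution on the countable set of multisets (discrete topology) means $\Pr[\mathcal{R}(\mathsf{G}_{n,N})=G]\to\Pr[\Gamma G_{>m}(\rho)=G]$ for every $G\in\mathcal{G}_{>m}$. *)

theory Defs
  imports "HOL-Probability.Probability" "HOL-Analysis.FPS_Convergence"
begin

definition combinatorial_class :: "'a set \<Rightarrow> ('a \<Rightarrow> nat) \<Rightarrow> bool" where
  "combinatorial_class C sz \<longleftrightarrow>
     countable C \<and> (\<forall>c\<in>C. 1 \<le> sz c) \<and> (\<forall>n. finite {c\<in>C. sz c = n})"

definition gen_series :: "'a set \<Rightarrow> ('a \<Rightarrow> nat) \<Rightarrow> real fps" where
  "gen_series C sz = Abs_fps (\<lambda>n. real (card {c\<in>C. sz c = n}))"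

text \<open>The ratio condition already forces the radius of convergence to be \<open>\<rho>\<close>; the summability
  clause expresses that the value of the series at \<open>\<rho>\<close>, which lies on the boundary of the disc
  of convergence, is finite.\<close>

definition subexponential :: "real fps \<Rightarrow> real \<Rightarrow> bool" where
  "subexponential f \<rho> \<longleftrightarrow>
     fps_nth f 0 = 0 \<and> \<rho> > 0 \<and>
     (\<forall>\<^sub>F n in sequentially. fps_nth f n > 0) \<and>
     (\<lambda>n. fps_nth f (n - 1) / fps_nth f n) \<longlonglongrightarrow> \<rho> \<and>
     summable (\<lambda>k. fps_nth f k * \<rho> ^ k) \<and>
     (\<lambda>n. (\<Sum>k=1..n. fps_nth f k * fps_nth f (n - k)) / fps_nth f n)
       \<longlonglongrightarrow> 2 * eval_fps f \<rho>"

definition min_size :: "'a set \<Rightarrow> ('a \<Rightarrow> nat) \<Rightarrow> nat" where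
  "min_size C sz = (LEAST k. 1 \<le> k \<and> fps_nth (gen_series C sz) k > 0)"

text \<open>A finite set of pairs (object, multiplicity) with distinct objects and positive
  multiplicities is a library multiset; its number of components is \<^const>\<open>size\<close>.\<close>

definition total_size :: "('a \<Rightarrow> nat) \<Rightarrow> 'a multiset \<Rightarrow> nat" where
  "total_size sz G = (\<Sum>c\<in>#G. sz c)"

definition multisets_of :: "'a set \<Rightarrow> ('a \<Rightarrow> nat) \<Rightarrow> nat \<Rightarrow> nat \<Rightarrow> 'a multiset set" where
  "multisets_of C sz n N = {G. set_mset G \<subseteq> C \<and> total_size sz G = n \<and> size G = N}"

definition multisets_above :: "'a set \<Rightarrow> ('a \<Rightarrow> nat) \<Rightarrow> nat \<Rightarrow> 'a multiset set" where
  "multisets_above C sz m = {G. set_mset G \<subseteq> C \<and> (\<forall>c\<in>#G. sz c > m)}"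

text \<open>Among the objects of largest size, the canonical one is the one coming first in the
  numbering \<open>idx\<close>.\<close>

definition largest :: "('a \<Rightarrow> nat) \<Rightarrow> ('a \<Rightarrow> nat) \<Rightarrow> 'a multiset \<Rightarrow> 'a" where
  "largest sz idx G = (ARG_MIN idx c. c \<in># G \<and> (\<forall>d\<in>#G. sz d \<le> sz c))"

text \<open>Multiset subtraction is truncated, so if all objects of \<open>G\<close> have size \<open>m\<close> (or \<open>G\<close> is empty)
  the remainder is empty.\<close>

definition remainder ::
    "('a \<Rightarrow> nat) \<Rightarrow> ('a \<Rightarrow> nat) \<Rightarrow> nat \<Rightarrow> 'a multiset \<Rightarrow> 'a multiset" where
  "remainder sz idx m G = filter_mset (\<lambda>c. sz c \<noteq> m) G - {#largest sz idx G#}"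

text \<open>The sum over \<open>j \<ge> 1\<close> is indexed by \<open>j = Suc i\<close>.\<close>

definition limit_prob ::
    "'a set \<Rightarrow> ('a \<Rightarrow> nat) \<Rightarrow> real \<Rightarrow> nat \<Rightarrow> 'a multiset \<Rightarrow> real" where
  "limit_prob C sz \<rho> m G =
     exp (- (\<Sum>i. let j = Suc i in
               (eval_fps (gen_series C sz) (\<rho> ^ j) - fps_nth (gen_series C sz) m * \<rho> ^ (j * m))
                 / (real j * \<rho> ^ (j * m))))
     * \<rho> powi (int (total_size sz G) - int (m * size G))"

end

theory Submission
  imports Defs
begin

text \<open>Give an object \<open>c\<close> of size larger than \<open>m\<close> the weight \<open>sz c - m\<close>. An element of
  \<open>\<G>\<^bsub>n,N\<^esub>\<close> is a multiset of objects of size \<open>m\<close> together with a multiset of heavy objects of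
  total weight \<open>L = n - m N\<close>. If \<open>b\<^sub>k\<close> and \<open>a\<^sub>L\<close> count heavy objects and multisets of them by
  weight and \<open>p(N)\<close> counts the multisets of \<open>N\<close> objects of size \<open>m\<close>, then
  \<open>|\<G>\<^bsub>n,N\<^esub>| \<le> p(N) a\<^sub>L\<close>. On the other hand, adding to a fixed heavy multiset \<open>R\<close> one of the
  \<open>b\<^bsub>L - wt R\<^esub>\<close> objects of the missing weight, which for large \<open>L\<close> is the unique largest one,
  yields \<open>b\<^bsub>L - wt R\<^esub> p(N - |R| - 1)\<close> multisets with remainder \<open>R\<close>. As \<open>p\<close> is a polynomial and
  \<open>b\<^bsub>L - j\<^esub> / b\<^sub>L \<longlonglongrightarrow> \<rho>\<^sup>j\<close>, the bound \<open>limsup a\<^sub>L / b\<^sub>L \<le> Z\<close> with \<open>Z = \<Sum>\<^sub>R \<rho>\<^bsup>wt R\<^esup>\<close> gives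
  \<open>liminf Pr[R] \<ge> \<rho>\<^bsup>wt R\<^esup> / Z\<close>. These lower bounds sum to \<open>1\<close>, so they are the limits.

  The bound on \<open>a\<^sub>L / b\<^sub>L\<close> comes from the recursion \<open>L a\<^sub>L = \<Sum>\<^sub>k W\<^sub>k a\<^bsub>L - k\<^esub>\<close> with
  \<open>W\<^sub>k = \<Sum>\<^bsub>d dvd k\<^esub> d b\<^sub>d\<close>, which is asymptotic to \<open>k b\<^sub>k\<close>: subexponentiality makes the middle
  of the sum negligible, the terms with small \<open>k\<close> carry a factor of order \<open>1 / L\<close>, and those with small
  \<open>L - k\<close> converge to a partial sum of \<open>Z\<close>.\<close>

section \<open>Subexponential sequences\<close>

text \<open>The upper end is indexed by its distance \<open>j = L - k\<close> from \<open>L\<close>,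
  so that for fixed \<open>T\<close> both ends are sums of fixed length whose terms can be taken to
  the limit one by one.\<close>

lemma sum_split_ends:
  fixes g :: "nat \<Rightarrow> 'b::comm_monoid_add"
  assumes "1 \<le> T" "2 * T \<le> L"
  shows "(\<Sum>k=1..L. g k) = (\<Sum>k=1..<T. g k) + (\<Sum>k=T..L-T. g k) + (\<Sum>j<T. g (L - j))"
proof -
  have "{1..L} = ({1..<T} \<union> {T..L-T}) \<union> {L-T<..L}"
    using assms by auto
  then have "(\<Sum>k=1..L. g k) = (\<Sum>k=1..<T. g k) + (\<Sum>k=T..L-T. g k) + (\<Sum>k\<in>{L-T<..L}. g k)"
    using assms by (simp only:) (subst sum.union_disjoint; auto)+
  also have "(\<Sum>k\<in>{L-T<..L}. g k) = (\<Sum>j<T. g (L - j))"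
    by (rule sum.reindex_bij_witness[of _ "\<lambda>j. L - j" "\<lambda>k. L - k"]) (use assms in auto)
  finally show ?thesis .
qed

text \<open>The quotient is a product of \<open>j\<close> consecutive ratios, each tending to
  \<rho>.\<close>

lemma tendsto_ratio_power:
  fixes f :: "nat \<Rightarrow> real"
  assumes pos: "\<forall>\<^sub>F n in sequentially. f n > 0"
    and ratio: "(\<lambda>n. f (n - 1) / f n) \<longlonglongrightarrow> \<rho>"
  shows "(\<lambda>n. f (n - j) / f n) \<longlonglongrightarrow> \<rho> ^ j"
proof (induction j)
  case 0
  have "\<forall>\<^sub>F n in sequentially. f (n - 0) / f n = 1"
    using pos by eventually_elim simp
  then show ?case
    by (simp add: tendsto_eventually)
next
  case (Suc j)
  have shift: "filterlim (\<lambda>n. n - j) sequentially sequentially"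
    by (rule filterlim_minus_const_nat_at_top)
  have "(\<lambda>n. (f (n - j - 1) / f (n - j)) * (f (n - j) / f n)) \<longlonglongrightarrow> \<rho> * \<rho> ^ j"
    by (intro tendsto_mult Suc filterlim_compose[OF ratio shift])
  moreover have "\<forall>\<^sub>F n in sequentially.
      (f (n - j - 1) / f (n - j)) * (f (n - j) / f n) = f (n - Suc j) / f n"
    using eventually_compose_filterlim[OF pos shift] by eventually_elim simp
  ultimately show ?case
    by (simp add: tendsto_cong del: divide_eq_0_iff times_divide_eq_left times_divide_eq_right)
qed

text \<open>Each end of the convolution, divided by \<open>f n\<close>, tends to a partial sum of
  the series at \<rho>. Together the ends use up the limit \<open>2 * S\<close> except for twice a
  tail, and that tail is the limit of the middle.\<close>

lemma convolution_middle_small: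
  fixes f :: "nat \<Rightarrow> real"
  assumes pos: "\<forall>\<^sub>F n in sequentially. f n > 0"
    and ratio: "(\<lambda>n. f (n - 1) / f n) \<longlonglongrightarrow> \<rho>"
    and zero: "f 0 = 0"
    and summable: "summable (\<lambda>k. f k * \<rho> ^ k)"
    and conv: "(\<lambda>n. (\<Sum>k=1..n. f k * f (n - k)) / f n) \<longlonglongrightarrow> 2 * (\<Sum>k. f k * \<rho> ^ k)"
    and \<epsilon>: "\<epsilon> > 0"
  shows "\<forall>\<^sub>F T in sequentially. \<forall>\<^sub>F n in sequentially. (\<Sum>k=T..n-T. f k * f (n - k)) \<le> \<epsilon> * f n"
proof -
  define S where "S = (\<Sum>k. f k * \<rho> ^ k)"
  have "(\<lambda>T. 2 * S - 2 * (\<Sum>k<T. f k * \<rho> ^ k)) \<longlonglongrightarrow> 2 * S - 2 * S"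
    unfolding S_def by (intro tendsto_intros summable_LIMSEQ summable)
  then have "\<forall>\<^sub>F T in sequentially. 2 * S - 2 * (\<Sum>k<T. f k * \<rho> ^ k) < \<epsilon>"
    using \<epsilon> by (intro order_tendstoD(2)) auto
  then show ?thesis
    using eventually_ge_at_top[of 1]
  proof eventually_elim
    case (elim T)
    have "(\<lambda>n. (\<Sum>k=1..n. f k * f (n - k)) / f n - 2 * (\<Sum>k<T. f k * (f (n - k) / f n)))
        \<longlonglongrightarrow> 2 * S - 2 * (\<Sum>k<T. f k * \<rho> ^ k)"
      unfolding S_def by (intro tendsto_intros conv tendsto_ratio_power pos ratio)
    then have "\<forall>\<^sub>F n in sequentially.
        (\<Sum>k=1..n. f k * f (n - k)) / f n - 2 * (\<Sum>k<T. f k * (f (n - k) / f n)) < \<epsilon>"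
      using elim by (intro order_tendstoD(2)) auto
    then show ?case
      using pos eventually_ge_at_top[of "2 * T"]
    proof eventually_elim
      case (elim n)
      \<comment> \<open>Since \<open>f 0 = 0\<close>, the index 0 may be added to the lower end,
        which then mirrors the upper end exactly.\<close>
      have "{..<T} = insert 0 {1..<T}"
        using \<open>1 \<le> T\<close> by auto
      then have "(\<Sum>k=1..<T. f k * f (n - k)) = (\<Sum>k<T. f k * f (n - k))"
        by (simp add: zero)
      moreover have "(\<Sum>j<T. f (n - j) * f (n - (n - j))) = (\<Sum>k<T. f k * f (n - k))"
        using elim(3) by (intro sum.cong) auto
      ultimately have "(\<Sum>k=1..n. f k * f (n - k)) =
          2 * (\<Sum>k<T. f k * f (n - k)) + (\<Sum>k=T..n-T. f k * f (n - k))"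
        using sum_split_ends[OF \<open>1 \<le> T\<close> elim(3), of "\<lambda>k. f k * f (n - k)"] by simp
      moreover have "(\<Sum>k<T. f k * (f (n - k) / f n)) = (\<Sum>k<T. f k * f (n - k)) / f n"
        by (simp add: sum_divide_distrib)
      ultimately have "(\<Sum>k=T..n-T. f k * f (n - k)) / f n < \<epsilon>"
        using elim(1) by (simp add: add_divide_distrib)
      then show ?case
        using elim(2) by (simp add: pos_divide_less_eq)
    qed
  qed
qed

section \<open>Divisor sums are dominated by their largest divisor\<close>

lemma geometric_lower_bound:
  fixes f :: "nat \<Rightarrow> real"
  assumes pos: "\<forall>\<^sub>F n in sequentially. f n > 0"
    and ratio: "(\<lambda>n. f (n - 1) / f n) \<longlonglongrightarrow> \<rho>" and "\<rho> < \<sigma>" "0 < \<sigma>"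
  shows "\<exists>c>0. \<forall>\<^sub>F n in sequentially. c \<le> f n * \<sigma> ^ n"
proof -
  have "\<forall>\<^sub>F n in sequentially. f (n - 1) / f n < \<sigma> \<and> f n > 0"
    using order_tendstoD(2)[OF ratio \<open>\<rho> < \<sigma>\<close>] pos by eventually_elim simp
  then obtain n0 where n0: "\<And>n. n \<ge> n0 \<Longrightarrow> f (n - 1) / f n < \<sigma>" "\<And>n. n \<ge> n0 \<Longrightarrow> f n > 0"
    unfolding eventually_sequentially by auto
  \<comment> \<open>A ratio below \<sigma> means that \<open>f n * \<sigma> ^ n\<close> increases
    with \<open>n\<close>.\<close>
  have "f n0 * \<sigma> ^ n0 \<le> f n * \<sigma> ^ n" if "n \<ge> n0" for n
    using that
  proof (induction n rule: dec_induct)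
    case (step k)
    have "f k < \<sigma> * f (Suc k)"
      using n0[of "Suc k"] step by (simp add: pos_divide_less_eq)
    then have "f k * \<sigma> ^ k \<le> (\<sigma> * f (Suc k)) * \<sigma> ^ k"
      using \<open>0 < \<sigma>\<close> by (intro mult_right_mono) auto
    with step show ?case
      by (simp add: mult_ac)
  qed simp
  moreover have "f n0 * \<sigma> ^ n0 > 0"
    using n0 \<open>0 < \<sigma>\<close> by simp
  ultimately show ?thesis
    unfolding eventually_sequentially by blast
qed

text \<open>A proper divisor of \<open>n\<close> is at most \<open>n / 2\<close>, so its coefficient
  is of order at most \<open>\<rho> ^ (- n / 2)\<close>, whereas \<open>b n\<close> grows almost
  like \<open>\<rho> ^ (- n)\<close>. As \<rho> is below 1, the proper divisors are exponentially
  negligible.\<close>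

lemma divisor_sum_asymp:
  fixes b :: "nat \<Rightarrow> real"
  assumes nonneg: "\<And>n. b n \<ge> 0" and pos: "\<forall>\<^sub>F n in sequentially. b n > 0"
    and ratio: "(\<lambda>n. b (n - 1) / b n) \<longlonglongrightarrow> \<rho>" and \<rho>: "0 < \<rho>" "\<rho> < 1"
    and summable: "summable (\<lambda>k. b k * \<rho> ^ k)"
  shows "(\<lambda>n. (\<Sum>d | d dvd n. real d * b d) / (real n * b n)) \<longlonglongrightarrow> 1"
proof -
  \<comment> \<open>The contribution of proper divisors grows at most like \<open>s ^ (- n)\<close>
    up to a polynomial factor, and \<open>b n\<close> at least like \<open>\<sigma> ^ (- n)\<close>.
    Any \<sigma> strictly between \<rho> and \<open>s\<close> leaves the geometric gain
    \<open>(\<sigma> / s) ^ n\<close>.\<close>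
  define s where "s = sqrt \<rho>"
  have s: "0 < s" "s < 1" "s ^ 2 = \<rho>" "\<rho> < s"
    using \<rho> real_less_rsqrt[of \<rho> \<rho>] by (auto simp: s_def power2_eq_square)
  obtain \<sigma> where \<sigma>: "\<rho> < \<sigma>" "\<sigma> < s"
    using dense s(4) by blast
  then obtain c where c: "c > 0" "\<forall>\<^sub>F n in sequentially. c \<le> b n * \<sigma> ^ n"
    using geometric_lower_bound[OF pos ratio] \<rho> by fastforce
  have "Bseq (\<lambda>k. b k * \<rho> ^ k)"
    by (rule convergent_imp_Bseq[OF convergentI[OF summable_LIMSEQ_zero[OF summable]]])
  then obtain K where K: "K > 0" "\<And>k. norm (b k * \<rho> ^ k) \<le> K"
    unfolding Bseq_def by auto
  have K': "b k * \<rho> ^ k \<le> K" for k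
    using K(2)[of k] by auto
  have small: "(\<Sum>d | d dvd n \<and> d \<noteq> n. real d * b d) * s ^ n \<le> real n ^ 2 * K" if "n > 0" for n
  proof -
    have "real d * b d * s ^ n \<le> real n * K" if d: "d dvd n" "d \<noteq> n" for d
    proof -
      obtain e where e: "n = d * e"
        using d by blast
      with d \<open>n > 0\<close> have "e \<ge> 2"
        by (cases e) (auto intro: Suc_leI)
      then have "2 * d \<le> n"
        unfolding e by (simp add: mult.commute mult_le_mono1)
      then have "s ^ n \<le> s ^ (2 * d)"
        using s by (intro power_decreasing) auto
      also have "\<dots> = \<rho> ^ d"
        by (simp add: power_mult s)
      finally have "b d * s ^ n \<le> b d * \<rho> ^ d"
        using nonneg by (intro mult_left_mono) auto
      also have "\<dots> \<le> K"
        by (rule K')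
      finally have "real d * (b d * s ^ n) \<le> real n * K"
        using \<open>2 * d \<le> n\<close> K nonneg s by (intro mult_mono) auto
      then show ?thesis
        by (simp add: mult_ac)
    qed
    then have "(\<Sum>d | d dvd n \<and> d \<noteq> n. real d * b d * s ^ n)
        \<le> (\<Sum>d | d dvd n \<and> d \<noteq> n. real n * K)"
      by (intro sum_mono) auto
    also have "\<dots> = real (card {d. d dvd n \<and> d \<noteq> n}) * (real n * K)"
      by simp
    also have "\<dots> \<le> real n * (real n * K)"
    proof -
      have "{d. d dvd n \<and> d \<noteq> n} \<subseteq> {..<n}"
        using that by (auto dest: dvd_imp_le)
      then have "card {d. d dvd n \<and> d \<noteq> n} \<le> n"
        using card_mono[of "{..<n}"] by fastforce
      then show ?thesis
        using K by (intro mult_right_mono) auto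
    qed
    finally show ?thesis
      by (simp add: sum_distrib_left sum_distrib_right power2_eq_square mult_ac)
  qed
  define R where "R = (\<lambda>n. (\<Sum>d | d dvd n \<and> d \<noteq> n. real d * b d) / (real n * b n))"
  have "R \<longlonglongrightarrow> 0"
  proof (rule tendsto_sandwich[of "\<lambda>_. 0" R _ "\<lambda>n. K / c * (real n * (\<sigma> / s) ^ n)"])
    have "(\<lambda>n. K / c * (real n * (\<sigma> / s) ^ n)) \<longlonglongrightarrow> K / c * 0"
      using \<sigma> \<rho> s by (intro tendsto_mult tendsto_const powser_times_n_limit_0) auto
    then show "(\<lambda>n. K / c * (real n * (\<sigma> / s) ^ n)) \<longlonglongrightarrow> 0"
      by simp
    show "\<forall>\<^sub>F n in sequentially. 0 \<le> R n"
      using nonneg by (intro always_eventually) (auto simp: R_def intro!: divide_nonneg_nonneg sum_nonneg)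
    show "\<forall>\<^sub>F n in sequentially. R n \<le> K / c * (real n * (\<sigma> / s) ^ n)"
      using c(2) pos eventually_gt_at_top[of 0]
    proof eventually_elim
      case (elim n)
      define X where "X = (\<Sum>d | d dvd n \<and> d \<noteq> n. real d * b d)"
      have X: "X \<ge> 0"
        unfolding X_def by (intro sum_nonneg) (auto simp: nonneg)
      have "X * s ^ n * c \<le> (real n ^ 2 * K) * (b n * \<sigma> ^ n)"
        using s c K by (intro mult_mono[OF small[OF elim(3), folded X_def] elim(1)]) auto
      then show ?case
        using elim s c \<sigma> \<rho> unfolding R_def X_def[symmetric]
        by (simp add: field_simps power_divide power2_eq_square)
    qed
  qed simp
  then have "(\<lambda>n. 1 + R n) \<longlonglongrightarrow> 1 + 0"
    by (intro tendsto_intros)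
  moreover have "\<forall>\<^sub>F n in sequentially.
      1 + R n = (\<Sum>d | d dvd n. real d * b d) / (real n * b n)"
    using pos eventually_gt_at_top[of 0]
  proof eventually_elim
    case (elim n)
    have "{d. d dvd n} = insert n {d. d dvd n \<and> d \<noteq> n}"
      by auto
    moreover have "finite {d. d dvd n \<and> d \<noteq> n}"
      using finite_divisors_nat[OF elim(2)] by (rule rev_finite_subset) auto
    ultimately have "(\<Sum>d | d dvd n. real d * b d) = real n * b n + (\<Sum>d | d dvd n \<and> d \<noteq> n. real d * b d)"
      using elim by simp
    then show ?case
      using elim by (simp add: R_def add_divide_distrib)
  qed
  ultimately show ?thesis
    by (simp add: tendsto_cong)
qed

section \<open>Asymptotics of the Euler transform\<close>

text \<open>The assumption \<open>euler\<close> is the coefficient form of the logarithmic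
  derivative of \<open>exp (\<Sum>j. B(x ^ j) / j)\<close>, where \<open>B\<close> is the series of
  \<open>b\<close>. The constant \<open>S\<close> may be any bound on the partial sums of the series
  of \<open>a\<close> at \<rho>.\<close>

locale euler_transform_asymptotics =
  fixes a b :: "nat \<Rightarrow> real" and \<rho> S :: real
  assumes a_nonneg: "\<And>n. a n \<ge> 0" and b_nonneg: "\<And>n. b n \<ge> 0"
    and b_pos: "\<forall>\<^sub>F n in sequentially. b n > 0"
    and ratio: "(\<lambda>n. b (n - 1) / b n) \<longlonglongrightarrow> \<rho>"
    and \<rho>: "0 < \<rho>" "\<rho> < 1"
    and summable: "summable (\<lambda>k. b k * \<rho> ^ k)"
    and middle: "\<And>\<epsilon>. \<epsilon> > 0 \<Longrightarrow>
      \<forall>\<^sub>F T in sequentially. \<forall>\<^sub>F n in sequentially. (\<Sum>k=T..n-T. b k * b (n - k)) \<le> \<epsilon> * b n"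
    and euler: "\<And>n. real n * a n = (\<Sum>k=1..n. (\<Sum>d | d dvd k. real d * b d) * a (n - k))"
    and S: "\<And>T. (\<Sum>j<T. a j * \<rho> ^ j) \<le> S"
begin

definition W :: "nat \<Rightarrow> real" where
  "W k = (\<Sum>d | d dvd k. real d * b d)"

lemma W_nonneg: "W k \<ge> 0"
  unfolding W_def by (intro sum_nonneg) (simp add: b_nonneg)

lemma S_nonneg: "S \<ge> 0"
  using S[of 0] by simp

lemma W_le: "\<forall>\<^sub>F k in sequentially. W k \<le> 2 * (real k * b k)"
proof -
  have "(\<lambda>n. W n / (real n * b n)) \<longlonglongrightarrow> 1"
    unfolding W_def by (rule divisor_sum_asymp[OF b_nonneg b_pos ratio \<rho> summable])
  \<comment> \<open>The 2 stands for an arbitrary constant above the limit 1.\<close>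
  then have "\<forall>\<^sub>F n in sequentially. W n / (real n * b n) < 2"
    by (rule order_tendstoD(2)) simp
  then show ?thesis
    using b_pos eventually_gt_at_top[of 0]
    by eventually_elim (simp add: pos_divide_less_eq)
qed

lemma W_shift_asymp: "(\<lambda>n. W (n - j) / (real n * b n)) \<longlonglongrightarrow> \<rho> ^ j"
proof -
  have shift: "filterlim (\<lambda>n. n - j) sequentially sequentially"
    by (rule filterlim_minus_const_nat_at_top)
  have "(\<lambda>n. W n / (real n * b n)) \<longlonglongrightarrow> 1"
    unfolding W_def by (rule divisor_sum_asymp[OF b_nonneg b_pos ratio \<rho> summable])
  then have "(\<lambda>n. W (n - j) / (real (n - j) * b (n - j)) * (b (n - j) / b n) * (real (n - j) / real n))
      \<longlonglongrightarrow> 1 * \<rho> ^ j * 1"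
  proof (intro tendsto_mult tendsto_ratio_power[OF b_pos ratio])
    have "(\<lambda>n. 1 - real j * inverse (real n)) \<longlonglongrightarrow> 1 - real j * 0"
      by (intro tendsto_intros LIMSEQ_inverse_real_of_nat lim_inverse_n)
    moreover have "\<forall>\<^sub>F n in sequentially. 1 - real j * inverse (real n) = real (n - j) / real n"
      using eventually_gt_at_top[of j] by eventually_elim (simp add: of_nat_diff field_simps)
    ultimately show "(\<lambda>n. real (n - j) / real n) \<longlonglongrightarrow> 1"
      by (simp add: tendsto_cong)
  qed (use filterlim_compose shift in blast)
  moreover have "\<forall>\<^sub>F n in sequentially.
      W (n - j) / (real (n - j) * b (n - j)) * (b (n - j) / b n) * (real (n - j) / real n)
      = W (n - j) / (real n * b n)"
    using eventually_compose_filterlim[OF b_pos shift] eventually_gt_at_top[of j]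
    by eventually_elim (simp add: field_simps del: of_nat_diff)
  ultimately show ?thesis
    by (simp add: tendsto_cong)
qed

section \<open>Bounding \<open>a\<close> by \<open>b\<close> through the recursion\<close>

text \<open>The block with \<open>j < T\<close> keeps the true values of \<open>a\<close>, because
  it produces the main term. In the other two blocks \<open>a\<close> is replaced by
  \<open>M * b\<close>, and in the middle one the factor \<open>k\<close> from \<open>W k\<close> is
  enlarged to \<open>L\<close>.\<close>

lemma recursion_bound:
  assumes T: "1 \<le> T" "2 * T \<le> L" and W2: "\<forall>k\<ge>T. W k \<le> 2 * (real k * b k)"
    and M: "M \<ge> 0" "\<And>j. T \<le> j \<Longrightarrow> j < L \<Longrightarrow> a j \<le> M * b j"
  shows "real L * a L \<le> (\<Sum>j<T. W (L - j) * a j) + M * (\<Sum>k=1..<T. W k * b (L - k))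
      + 2 * M * real L * (\<Sum>k=T..L-T. b k * b (L - k))"
proof -
  have "real L * a L = (\<Sum>k=1..<T. W k * a (L - k)) + (\<Sum>k=T..L-T. W k * a (L - k))
      + (\<Sum>j<T. W (L - j) * a (L - (L - j)))"
    unfolding euler W_def[symmetric] by (rule sum_split_ends[OF T])
  moreover have "(\<Sum>j<T. W (L - j) * a (L - (L - j))) = (\<Sum>j<T. W (L - j) * a j)"
    using T by (intro sum.cong) auto
  moreover have "(\<Sum>k=1..<T. W k * a (L - k)) \<le> (\<Sum>k=1..<T. W k * (M * b (L - k)))"
    using T by (intro sum_mono mult_left_mono M W_nonneg) auto
  moreover have "(\<Sum>k=T..L-T. W k * a (L - k)) \<le> (\<Sum>k=T..L-T. (2 * (real L * b k)) * (M * b (L - k)))"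
  proof (intro sum_mono mult_mono)
    fix k assume k: "k \<in> {T..L-T}"
    show "a (L - k) \<le> M * b (L - k)"
      using k T by (intro M) auto
    have "real k * b k \<le> real L * b k"
      using k by (intro mult_right_mono b_nonneg) auto
    then show "W k \<le> 2 * (real L * b k)"
      using W2[rule_format, of k] k by auto
  qed (auto simp: a_nonneg b_nonneg)
  ultimately show ?thesis
    by (simp add: sum_distrib_left mult_ac)
qed

text \<open>Division of the previous bound by \<open>L\<close> leaves a partial sum below
  \<open>S\<close> and two error terms proportional to \<open>M\<close>. The threshold for
  \<open>L\<close> is independent of \<open>M\<close>, which allows \<open>M\<close> to be chosen
  after it.\<close>

lemma coefficient_bound_step:
  assumes T: "1 \<le> T" and W2: "\<forall>k\<ge>T. W k \<le> 2 * (real k * b k)"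
    and mid: "\<forall>\<^sub>F n in sequentially. (\<Sum>k=T..n-T. b k * b (n - k)) \<le> \<delta> * b n"
    and \<eta>: "\<eta> > 0"
  shows "\<forall>\<^sub>F L in sequentially. \<forall>M\<ge>0. (\<forall>j. T \<le> j \<longrightarrow> j < L \<longrightarrow> a j \<le> M * b j) \<longrightarrow>
      a L \<le> (S + \<eta> + M * (\<eta> + 2 * \<delta>)) * b L"
proof -
  have "(\<lambda>L. \<Sum>j<T. W (L - j) / (real L * b L) * a j) \<longlonglongrightarrow> (\<Sum>j<T. \<rho> ^ j * a j)"
    by (intro tendsto_intros W_shift_asymp)
  moreover have "(\<Sum>j<T. \<rho> ^ j * a j) < S + \<eta>"
    using S[of T] \<eta> by (simp add: mult.commute)
  ultimately have H: "\<forall>\<^sub>F L in sequentially. (\<Sum>j<T. W (L - j) / (real L * b L) * a j) < S + \<eta>"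
    by (rule order_tendstoD(2))
  \<comment> \<open>For small \<open>k\<close> the weight \<open>W k\<close> does not grow with
    \<open>L\<close>, so the factor \<open>1 / L\<close> survives and sends the sum to 0.\<close>
  have "(\<lambda>L. \<Sum>k=1..<T. W k * (b (L - k) / b L) * inverse (real L)) \<longlonglongrightarrow> (\<Sum>k=1..<T. W k * \<rho> ^ k * 0)"
    by (intro tendsto_intros tendsto_ratio_power[OF b_pos ratio] lim_inverse_n)
  then have E: "\<forall>\<^sub>F L in sequentially. (\<Sum>k=1..<T. W k * (b (L - k) / b L) * inverse (real L)) < \<eta>"
    using \<eta> by (intro order_tendstoD(2)) auto
  show ?thesis
    using H E mid b_pos eventually_ge_at_top[of "2 * T"]
  proof eventually_elim
    case (elim L)
    have L: "real L > 0"
      using T elim by simp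
    have H': "(\<Sum>j<T. W (L - j) * a j) \<le> (S + \<eta>) * (real L * b L)"
    proof -
      have "(\<Sum>j<T. W (L - j) / (real L * b L) * a j) = (\<Sum>j<T. W (L - j) * a j) / (real L * b L)"
        by (simp add: sum_divide_distrib)
      then show ?thesis
        using elim L by (simp add: pos_divide_less_eq)
    qed
    have E': "(\<Sum>k=1..<T. W k * b (L - k)) \<le> \<eta> * (real L * b L)"
    proof -
      have "(\<Sum>k=1..<T. W k * (b (L - k) / b L) * inverse (real L))
          = (\<Sum>k=1..<T. W k * b (L - k)) / (real L * b L)"
        by (simp add: sum_divide_distrib field_simps)
      then show ?thesis
        using elim L by (simp add: pos_divide_less_eq)
    qed
    show ?case
    proof (intro allI impI)
      fix M :: real
      assume M: "M \<ge> 0" "\<forall>j. T \<le> j \<longrightarrow> j < L \<longrightarrow> a j \<le> M * b j"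
      have "real L * a L \<le> (\<Sum>j<T. W (L - j) * a j) + M * (\<Sum>k=1..<T. W k * b (L - k))
          + 2 * M * real L * (\<Sum>k=T..L-T. b k * b (L - k))"
        using M elim by (intro recursion_bound T W2) auto
      also have "\<dots> \<le> (S + \<eta>) * (real L * b L) + M * (\<eta> * (real L * b L)) + 2 * M * real L * (\<delta> * b L)"
        using M elim by (intro add_mono mult_left_mono H' E') auto
      also have "\<dots> = real L * ((S + \<eta> + M * (\<eta> + 2 * \<delta>)) * b L)"
        by (simp add: algebra_simps)
      finally show "a L \<le> (S + \<eta> + M * (\<eta> + 2 * \<delta>)) * b L"
        using L by simp
    qed
  qed
qed

text \<open>With small errors the step multiplies \<open>M\<close> by only
  \<open>1/4 + 2/8 = 1/2\<close>, so a sufficiently large constant reproduces itself in a strong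
  induction.\<close>

lemma coefficient_bounded:
  "\<exists>M T. M \<ge> 0 \<and> (\<forall>n\<ge>T. a n \<le> M * b n)"
proof -
  have "\<forall>\<^sub>F T in sequentially. \<forall>k\<ge>T. W k \<le> 2 * (real k * b k) \<and> b k > 0"
    using W_le b_pos eventually_all_ge_at_top eventually_conj by blast
  then have "\<forall>\<^sub>F T in sequentially. 1 \<le> T \<and> (\<forall>k\<ge>T. W k \<le> 2 * (real k * b k) \<and> b k > 0) \<and>
      (\<forall>\<^sub>F n in sequentially. (\<Sum>k=T..n-T. b k * b (n - k)) \<le> 1/8 * b n)"
    by (intro eventually_conj middle eventually_ge_at_top) auto
  from eventually_happens'[OF sequentially_bot this]
  obtain T where T: "1 \<le> T" "\<forall>k\<ge>T. W k \<le> 2 * (real k * b k)"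
      "\<And>k. k \<ge> T \<Longrightarrow> b k > 0"
      "\<forall>\<^sub>F n in sequentially. (\<Sum>k=T..n-T. b k * b (n - k)) \<le> 1/8 * b n"
    by auto
  obtain L0 where L0: "\<And>L M. L \<ge> L0 \<Longrightarrow> M \<ge> 0 \<Longrightarrow> (\<forall>j. T \<le> j \<longrightarrow> j < L \<longrightarrow> a j \<le> M * b j) \<Longrightarrow>
      a L \<le> (S + 1/4 + M * (1/4 + 2 * (1/8))) * b L"
    using coefficient_bound_step[OF T(1,2,4), of "1/4"] unfolding eventually_sequentially by auto
  \<comment> \<open>\<open>2 * (S + 1/4)\<close> is the fixed point of
    \<open>x \<mapsto> S + 1/4 + x / 2\<close>, and adding the nonnegative \<open>Q\<close> keeps
    \<open>M\<close> above its image. \<open>Q\<close> itself settles the finitely many indices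
    below \<open>L0\<close>; a term with \<open>b j = 0\<close> counts as 0 there, which is harmless
    since \<open>b\<close> is positive from \<open>T\<close> on.\<close>
  define Q where "Q = (\<Sum>j<L0. a j / b j)"
  define M where "M = 2 * (S + 1/4) + Q"
  have terms: "0 \<le> a j / b j" for j
    by (simp add: a_nonneg b_nonneg)
  have Q: "0 \<le> Q"
    unfolding Q_def by (intro sum_nonneg terms)
  have M: "M \<ge> 0"
    using Q S_nonneg unfolding M_def by simp
  have "a n \<le> M * b n" if "n \<ge> T" for n
    using that
  proof (induction n rule: less_induct)
    case (less n)
    show ?case
    proof (cases "n < L0")
      case True
      then have "a n / b n \<le> Q"
        unfolding Q_def using terms by (intro member_le_sum) auto
      also have "\<dots> \<le> M"
        using S_nonneg unfolding M_def by simp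
      finally show ?thesis
        using T(3)[OF less.prems] by (simp add: pos_divide_le_eq)
    next
      case False
      then have "a n \<le> (S + 1/4 + M * (1/4 + 2 * (1/8))) * b n"
        using less M by (intro L0) auto
      also have "\<dots> \<le> M * b n"
        using Q unfolding M_def by (intro mult_right_mono b_nonneg) (simp add: field_simps)
      finally show ?thesis .
    qed
  qed
  with M show ?thesis
    by blast
qed

text \<open>One further application of the step suffices: the a priori constant \<open>M\<close> is
  now fixed, so the errors multiplying it can be made arbitrarily small.\<close>

theorem coefficient_limsup:
  assumes "\<epsilon> > 0"
  shows "\<forall>\<^sub>F n in sequentially. a n \<le> (S + \<epsilon>) * b n"
proof -
  obtain M T0 where M: "M \<ge> 0" "\<And>n. n \<ge> T0 \<Longrightarrow> a n \<le> M * b n"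
    using coefficient_bounded by blast
  \<comment> \<open>Chosen so that taking \<eta> for both error parameters gives a total error of
    exactly \<epsilon>.\<close>
  define \<eta> where "\<eta> = \<epsilon> / (1 + 3 * M)"
  have \<eta>: "\<eta> > 0" and "\<eta> * (1 + 3 * M) = \<epsilon>"
    using M assms by (auto simp: \<eta>_def)
  then have \<eta>_eq: "\<eta> + M * (\<eta> + 2 * \<eta>) = \<epsilon>"
    by (simp add: algebra_simps)
  have "\<forall>\<^sub>F T in sequentially. \<forall>k\<ge>T. W k \<le> 2 * (real k * b k)"
    using W_le eventually_all_ge_at_top by blast
  then have "\<forall>\<^sub>F T in sequentially. max 1 T0 \<le> T \<and> (\<forall>k\<ge>T. W k \<le> 2 * (real k * b k)) \<and>
      (\<forall>\<^sub>F n in sequentially. (\<Sum>k=T..n-T. b k * b (n - k)) \<le> \<eta> * b n)"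
    by (intro eventually_conj middle eventually_ge_at_top \<eta>) auto
  from eventually_happens'[OF sequentially_bot this]
  obtain T where T: "1 \<le> T" "T0 \<le> T" "\<forall>k\<ge>T. W k \<le> 2 * (real k * b k)"
      "\<forall>\<^sub>F n in sequentially. (\<Sum>k=T..n-T. b k * b (n - k)) \<le> \<eta> * b n"
    by auto
  show ?thesis
    using coefficient_bound_step[OF T(1,3,4) \<eta>]
  proof eventually_elim
    case (elim n)
    then have "a n \<le> (S + \<eta> + M * (\<eta> + 2 * \<eta>)) * b n"
      using M T(2) by auto
    then show ?case
      using \<eta>_eq by (simp add: add.assoc)
  qed
qed

end

section \<open>Multisets over a weighted class\<close>

lemma sum_mset_eq_sum_superset:
  fixes f :: "'a \<Rightarrow> nat"
  assumes "finite A" "set_mset M \<subseteq> A"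
  shows "(\<Sum>x\<in>#M. f x) = (\<Sum>x\<in>A. count M x * f x)"
  using assms(2)
proof (induction M)
  case (add y M)
  have "(\<Sum>x\<in>A. count (add_mset y M) x * f x)
      = (\<Sum>x\<in>A. (if x = y then f x else 0) + count M x * f x)"
    by (intro sum.cong) auto
  also have "\<dots> = f y + (\<Sum>x\<in>A. count M x * f x)"
    using add.prems assms(1) by (simp add: sum.distrib)
  finally show ?case
    using add by simp
qed simp

locale weighted_class =
  fixes D :: "'a set" and w :: "'a \<Rightarrow> nat"
  assumes w_pos: "c \<in> D \<Longrightarrow> w c \<ge> 1"
    and finite_level: "finite {c\<in>D. w c = k}"
begin

definition wt :: "'a multiset \<Rightarrow> nat" where
  "wt H = (\<Sum>c\<in>#H. w c)"

definition msets :: "nat \<Rightarrow> 'a multiset set" where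
  "msets L = {H. set_mset H \<subseteq> D \<and> wt H = L}"

definition obj_count :: "nat \<Rightarrow> nat" where
  "obj_count k = card {c\<in>D. w c = k}"

definition mset_count :: "nat \<Rightarrow> nat" where
  "mset_count L = card (msets L)"

lemma wt_simps [simp]: "wt {#} = 0" "wt (add_mset c H) = w c + wt H" "wt (G + H) = wt G + wt H"
  "wt (replicate_mset j c) = j * w c"
  by (auto simp: wt_def)

lemma finite_le: "finite {c\<in>D. w c \<le> L}"
proof -
  have "{c\<in>D. w c \<le> L} = (\<Union>k\<le>L. {c\<in>D. w c = k})"
    by auto
  then show ?thesis
    by (simp add: finite_level)
qed

lemma w_le_wt: "c \<in># H \<Longrightarrow> w c \<le> wt H"
  by (induction H) auto

lemma size_le_wt: "set_mset H \<subseteq> D \<Longrightarrow> size H \<le> wt H"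
proof (induction H)
  case (add c H)
  then show ?case
    using w_pos[of c] by auto
qed simp

lemma finite_msets: "finite (msets L)"
proof (rule finite_subset)
  show "msets L \<subseteq> (\<Union>k\<le>L. multisets_of_size {c\<in>D. w c \<le> L} k)"
    using size_le_wt w_le_wt by (fastforce simp: msets_def multisets_of_size_def)
  show "finite (\<Union>k\<le>L. multisets_of_size {c\<in>D. w c \<le> L} k)"
    using finite_le by (auto intro: finite_multisets_of_size)
qed

section \<open>Multiplicities and the Euler recursion\<close>

text \<open>Removing \<open>j\<close> copies of \<open>c\<close> is a bijection onto the multisets
  of weight \<open>L - j * w c\<close>.\<close>

lemma card_msets_count_ge:
  assumes "c \<in> D"
  shows "card {H \<in> msets L. j \<le> count H c} = (if j * w c \<le> L then mset_count (L - j * w c) else 0)"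
proof (cases "j * w c \<le> L")
  case True
  have "bij_betw (\<lambda>H. H + replicate_mset j c) (msets (L - j * w c)) {H \<in> msets L. j \<le> count H c}"
  proof (rule bij_betwI[where g = "\<lambda>H. H - replicate_mset j c"])
    show "(\<lambda>H. H - replicate_mset j c) \<in> {H \<in> msets L. j \<le> count H c} \<rightarrow> msets (L - j * w c)"
    proof
      fix H assume H: "H \<in> {H \<in> msets L. j \<le> count H c}"
      then have "replicate_mset j c \<subseteq># H"
        by (simp add: count_le_replicate_mset_subset_eq)
      then obtain H' where "H = replicate_mset j c + H'"
        using mset_subset_eq_exists_conv by blast
      with H show "H - replicate_mset j c \<in> msets (L - j * w c)"
        by (auto simp: msets_def)
    qed
  qed (use assms True in \<open>auto simp: msets_def count_le_replicate_mset_subset_eq split: if_splits\<close>)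
  then show ?thesis
    using True by (simp add: bij_betw_same_card mset_count_def)
next
  case False
  have "wt H \<ge> j * w c" if "j \<le> count H c" for H
  proof -
    have "replicate_mset j c \<subseteq># H"
      using that by (simp add: count_le_replicate_mset_subset_eq)
    then obtain H' where "H = replicate_mset j c + H'"
      using mset_subset_eq_exists_conv by blast
    then show ?thesis
      by simp
  qed
  then have empty: "{H \<in> msets L. j \<le> count H c} = {}"
    using False by (fastforce simp: msets_def)
  show ?thesis
    unfolding empty using False by simp
qed

text \<open>Double counting of the total weight of all multisets of weight \<open>L\<close>.\<close>

lemma euler_recursion:
  "L * mset_count L = (\<Sum>k=1..L. (\<Sum>d | d dvd k. d * obj_count d) * mset_count (L - k))"
proof -
  have le: "i \<le> L \<and> k \<le> L" if "Suc 0 \<le> i" "Suc 0 \<le> k" "i * k \<le> L" for i k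
    using that le_trans[of i "i * k" L] le_trans[of k "i * k" L] by simp
  let ?A = "{c\<in>D. w c \<le> L}"
  let ?h = "\<lambda>d j. if j * d \<le> L then mset_count (L - j * d) else 0"
  have "L * mset_count L = (\<Sum>H\<in>msets L. wt H)"
    by (simp add: mset_count_def msets_def)
  also have "\<dots> = (\<Sum>H\<in>msets L. \<Sum>c\<in>?A. count H c * w c)"
    unfolding wt_def
  proof (intro sum.cong refl sum_mset_eq_sum_superset finite_le)
    fix H assume "H \<in> msets L"
    then show "set_mset H \<subseteq> ?A"
      using w_le_wt by (auto simp: msets_def)
  qed
  also have "\<dots> = (\<Sum>c\<in>?A. w c * (\<Sum>H\<in>msets L. count H c))"
    by (subst sum.swap) (simp add: sum_distrib_left mult.commute)
  also have "\<dots> = (\<Sum>c\<in>?A. \<Sum>j=1..L. w c * ?h (w c) j)"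
  proof (intro sum.cong refl)
    fix c assume c: "c \<in> ?A"
    \<comment> \<open>The multiplicity is counted as the number of \<open>j\<close> with
      \<open>1 \<le> j \<le> count H c\<close>, so that summing over \<open>H\<close> leaves the
      cardinalities just computed.\<close>
    have "count H c = (\<Sum>j=1..L. if j \<le> count H c then 1 else 0)" if "H \<in> msets L" for H
    proof -
      have "count H c \<le> L"
        using that size_le_wt[of H] count_le_size[of H c] by (auto simp: msets_def)
      then have "{1..L} \<inter> {j. j \<le> count H c} = {1..count H c}"
        by auto
      then show ?thesis
        by (simp add: sum.If_cases)
    qed
    then have "(\<Sum>H\<in>msets L. count H c) = (\<Sum>H\<in>msets L. \<Sum>j=1..L. if j \<le> count H c then 1 else 0)"
      by (intro sum.cong) auto
    also have "\<dots> = (\<Sum>j=1..L. card {H \<in> msets L. j \<le> count H c})"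
      by (subst sum.swap) (simp add: sum.If_cases finite_msets Int_def)
    also have "\<dots> = (\<Sum>j=1..L. ?h (w c) j)"
      using c by (intro sum.cong refl card_msets_count_ge) auto
    finally show "w c * (\<Sum>H\<in>msets L. count H c) = (\<Sum>j=1..L. w c * ?h (w c) j)"
      by (simp add: sum_distrib_left)
  qed
  also have "\<dots> = (\<Sum>d=1..L. \<Sum>c\<in>{c\<in>?A. w c = d}. \<Sum>j=1..L. w c * ?h (w c) j)"
    using w_pos finite_le by (intro sum.group[symmetric]) auto
  also have "\<dots> = (\<Sum>d=1..L. obj_count d * (\<Sum>j=1..L. d * ?h d j))"
  proof (intro sum.cong refl)
    fix d assume "d \<in> {1..L}"
    then have "{c\<in>?A. w c = d} = {c\<in>D. w c = d}"
      by auto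
    then have "(\<Sum>c\<in>{c\<in>?A. w c = d}. \<Sum>j=1..L. w c * ?h (w c) j)
        = (\<Sum>c\<in>{c\<in>D. w c = d}. \<Sum>j=1..L. d * ?h d j)"
      by (intro sum.cong) auto
    then show "(\<Sum>c\<in>{c\<in>?A. w c = d}. \<Sum>j=1..L. w c * ?h (w c) j) = obj_count d * (\<Sum>j=1..L. d * ?h d j)"
      by (simp add: obj_count_def)
  qed
  also have "\<dots> = (\<Sum>(d, j)\<in>{1..L} \<times> {1..L}. obj_count d * (d * ?h d j))"
    by (simp add: sum.cartesian_product sum_distrib_left)
  also have "\<dots> = (\<Sum>(d, j)\<in>{(d, j) \<in> {1..L} \<times> {1..L}. j * d \<le> L}. obj_count d * (d * mset_count (L - j * d)))"
    by (intro sum.mono_neutral_cong_right) (auto split: if_splits)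
  \<comment> \<open>The pairs are regrouped by the product \<open>k = j * d\<close>, which turns
    \<open>d\<close> into a divisor of \<open>k\<close>.\<close>
  also have "\<dots> = (\<Sum>(k, d)\<in>(SIGMA k:{1..L}. {d. d dvd k}). d * obj_count d * mset_count (L - k))"
    by (rule sum.reindex_bij_witness[of _ "\<lambda>(k, d). (d, k div d)" "\<lambda>(d, j). (j * d, d)"])
       (auto simp: mult_ac dvd_imp_le elim!: dvdE dest: le)
  also have "\<dots> = (\<Sum>k=1..L. (\<Sum>d | d dvd k. d * obj_count d) * mset_count (L - k))"
    by (subst sum.Sigma[symmetric]) (auto simp: sum_distrib_right)
  finally show ?thesis .
qed

section \<open>The generating function of multisets at a real point\<close>

lemma has_sum_over_levels:
  fixes f :: "nat \<Rightarrow> real"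
  assumes "\<And>k. f k \<ge> 0" "summable (\<lambda>k. real (obj_count k) * f k)"
  shows "((\<lambda>c. f (w c)) has_sum (\<Sum>k. real (obj_count k) * f k)) D"
proof -
  have level: "((\<lambda>c. case (k, c) of (k, c) \<Rightarrow> f k) has_sum (real (obj_count k) * f k)) {c\<in>D. w c = k}" for k
    using finite_level by (auto simp: obj_count_def intro: has_sum_finiteI)
  have sums: "((\<lambda>k. real (obj_count k) * f k) has_sum (\<Sum>k. real (obj_count k) * f k)) UNIV"
    using assms by (intro sums_nonneg_imp_has_sum summable_sums) auto
  have "((\<lambda>(k, c). f k) has_sum (\<Sum>k. real (obj_count k) * f k)) (SIGMA k:UNIV. {c\<in>D. w c = k})"
    using level sums assms(1)
    by (intro has_sum_SigmaI[OF level sums] summable_on_SigmaI[OF level has_sum_imp_summable[OF sums]]) auto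
  also have "?this \<longleftrightarrow> ((\<lambda>c. f (w c)) has_sum (\<Sum>k. real (obj_count k) * f k)) D"
    by (rule has_sum_reindex_bij_witness[of _ "\<lambda>c. (w c, c)" snd]) auto
  finally show ?thesis .
qed

text \<open>This is the finite Euler product. A multiset over \<open>insert c F\<close> is a
  multiplicity of \<open>c\<close> together with a multiset over \<open>F\<close>, and the
  multiplicity contributes a geometric series.\<close>

lemma geometric_msets:
  fixes r :: real
  assumes r: "0 < r" "r < 1" and "finite F" "F \<subseteq> D"
  shows "((\<lambda>H. r ^ wt H) has_sum (\<Prod>c\<in>F. 1 / (1 - r ^ w c))) {H. set_mset H \<subseteq> F}"
  using assms(3,4)
proof (induction F)
  case empty
  show ?case
    by (rule has_sum_finiteI) auto
next
  case (insert c F)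
  let ?P = "\<Prod>c\<in>F. 1 / (1 - r ^ w c)"
  have IH: "((\<lambda>H. r ^ wt H) has_sum ?P) {H. set_mset H \<subseteq> F}"
    using insert by auto
  have x: "0 \<le> r ^ w c" "r ^ w c < 1"
    using r w_pos[of c] insert.prems by (auto intro!: power_Suc_less_one simp: power_less_one_iff)
  have inner: "((\<lambda>H. case (n, H) of (n, H) \<Rightarrow> (r ^ w c) ^ n * r ^ wt H) has_sum ((r ^ w c) ^ n * ?P))
      {H. set_mset H \<subseteq> F}" for n
    using has_sum_cmult_right[OF IH, of "(r ^ w c) ^ n"] by simp
  have "(\<lambda>n. (r ^ w c) ^ n) sums (1 / (1 - r ^ w c))"
    using x by (intro geometric_sums) auto
  then have "((\<lambda>n. (r ^ w c) ^ n) has_sum (1 / (1 - r ^ w c))) UNIV"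
    using x by (intro sums_nonneg_imp_has_sum) auto
  then have outer: "((\<lambda>n. (r ^ w c) ^ n * ?P) has_sum (1 / (1 - r ^ w c) * ?P)) UNIV"
    by (rule has_sum_cmult_left)
  have "((\<lambda>(n, H). (r ^ w c) ^ n * r ^ wt H) has_sum (1 / (1 - r ^ w c) * ?P)) (UNIV \<times> {H. set_mset H \<subseteq> F})"
    using x r by (intro has_sum_SigmaI[OF inner outer] summable_on_SigmaI[OF inner has_sum_imp_summable[OF outer]]) auto
  also have "?this \<longleftrightarrow> ((\<lambda>H. r ^ wt H) has_sum (1 / (1 - r ^ w c) * ?P)) {H. set_mset H \<subseteq> insert c F}"
  proof (rule has_sum_reindex_bij_witness[of _ "\<lambda>H. (count H c, filter_mset (\<lambda>x. x \<noteq> c) H)"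
      "\<lambda>(n, H). replicate_mset n c + H"], goal_cases)
    case (1 a)
    then show ?case
      using \<open>c \<notin> F\<close> by (auto simp: multiset_eq_iff not_in_iff[symmetric])
  next
    case (3 b)
    then show ?case
      by (auto simp: multiset_eq_iff)
  qed (auto simp: power_add mult.commute simp flip: power_mult split: if_splits)
  finally show ?case
    using insert.hyps by simp
qed

text \<open>Each logarithm is expanded into its power series and the two sums are exchanged, all
  terms being nonnegative. For fixed \<open>i\<close> the sum over the objects is their generating
  series at \<open>r ^ Suc i\<close>.\<close>

lemma log_sum_swap:
  fixes r :: real
  assumes r: "0 < r" "r < 1" and summable: "summable (\<lambda>k. real (obj_count k) * r ^ k)"
  shows "((\<lambda>c. - ln (1 - r ^ w c)) has_sum
      (\<Sum>i. (\<Sum>k. real (obj_count k) * (r ^ Suc i) ^ k) / real (Suc i))) D"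
proof -
  have x: "0 \<le> r ^ w c" "r ^ w c < 1" "r ^ w c \<le> r" if "c \<in> D" for c
    using r w_pos[OF that] power_decreasing[of 1 "w c" r] by (auto simp: power_less_one_iff)
  have log: "((\<lambda>i. case (c, i) of (c, i) \<Rightarrow> (r ^ w c) ^ Suc i / real (Suc i)) has_sum (- ln (1 - r ^ w c))) UNIV"
    if "c \<in> D" for c
  proof -
    have "(\<lambda>n. - (- ((- (- (r ^ w c))) ^ n) / real n)) sums (- ln (1 + - (r ^ w c)))"
      using x[OF that] by (intro sums_minus ln_series') auto
    then have "(\<lambda>n. (r ^ w c) ^ n / real n) sums (- ln (1 - r ^ w c))"
      by simp
    then have "(\<lambda>n. (r ^ w c) ^ Suc n / real (Suc n)) sums (- ln (1 - r ^ w c))"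
      by (subst sums_Suc_iff) simp
    then show ?thesis
      using r by (auto intro!: sums_nonneg_imp_has_sum)
  qed
  \<comment> \<open>Comparison with the convergent object series:
    \<open>- ln (1 - x) \<le> x / (1 - x) \<le> x / (1 - r)\<close> for
    \<open>x = r ^ w c \<le> r\<close>.\<close>
  have "(\<lambda>c. - ln (1 - r ^ w c)) summable_on D"
  proof (rule summable_on_comparison_test)
    show "(\<lambda>c. r ^ w c * (1 / (1 - r))) summable_on D"
      using has_sum_over_levels[of "\<lambda>k. r ^ k"] r summable
      by (intro summable_on_cmult_left has_sum_imp_summable) auto
    show "- ln (1 - r ^ w c) \<le> r ^ w c * (1 / (1 - r))" if "c \<in> D" for c
    proof -
      have "ln (1 / (1 - r ^ w c)) \<le> 1 / (1 - r ^ w c) - 1"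
        using x[OF that] by (intro ln_le_minus_one) auto
      also have "1 / (1 - r ^ w c) - 1 = r ^ w c * (1 / (1 - r ^ w c))"
        using x[OF that] by (simp add: field_simps)
      also have "\<dots> \<le> r ^ w c * (1 / (1 - r))"
        using x[OF that] r by (intro mult_left_mono divide_left_mono) auto
      finally show ?thesis
        using x[OF that] by (simp add: ln_div)
    qed
    show "0 \<le> - ln (1 - r ^ w c)" if "c \<in> D" for c
      using x[OF that] by simp
  qed
  then have logs: "((\<lambda>c. - ln (1 - r ^ w c)) has_sum infsum (\<lambda>c. - ln (1 - r ^ w c)) D) D"
    by (rule has_sum_infsum)
  have "((\<lambda>(c, i). (r ^ w c) ^ Suc i / real (Suc i)) has_sum infsum (\<lambda>c. - ln (1 - r ^ w c)) D) (D \<times> UNIV)"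
    using r by (intro has_sum_SigmaI[OF log logs] summable_on_SigmaI[OF log has_sum_imp_summable[OF logs]]) auto
  then have "((\<lambda>(i, c). (r ^ w c) ^ Suc i / real (Suc i)) has_sum infsum (\<lambda>c. - ln (1 - r ^ w c)) D) (UNIV \<times> D)"
    by (subst (asm) has_sum_swap) simp
  then have "((\<lambda>i. (\<Sum>k. real (obj_count k) * (r ^ Suc i) ^ k) / real (Suc i))
      has_sum infsum (\<lambda>c. - ln (1 - r ^ w c)) D) UNIV"
  proof (rule has_sum_SigmaD)
    fix i :: nat
    have "summable (\<lambda>k. real (obj_count k) * (r ^ Suc i) ^ k)"
    proof (rule summable_comparison_test'[OF summable])
      fix k :: nat
      have "(r ^ Suc i) ^ k \<le> r ^ k"
        using r by (intro power_mono) (auto simp: mult_le_one power_le_one intro: mult_left_le)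
      then show "norm (real (obj_count k) * (r ^ Suc i) ^ k) \<le> real (obj_count k) * r ^ k"
        using r by (simp add: mult_left_mono abs_mult)
    qed
    then have "((\<lambda>c. (r ^ Suc i) ^ w c) has_sum (\<Sum>k. real (obj_count k) * (r ^ Suc i) ^ k)) D"
      using r by (intro has_sum_over_levels) auto
    from has_sum_divide_const[OF this, of "real (Suc i)"]
    show "((\<lambda>c. case (i, c) of (i, c) \<Rightarrow> (r ^ w c) ^ Suc i / real (Suc i)) has_sum
        (\<Sum>k. real (obj_count k) * (r ^ Suc i) ^ k) / real (Suc i)) D"
      by (simp only: prod.case power_mult[symmetric] mult.commute)
  qed
  from sums_unique[OF has_sum_imp_sums[OF this]] logs show ?thesis
    by simp
qed

text \<open>The finite Euler products are squeezed against the full sum. Finitely many multisets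
  involve only finitely many objects, so partial sums stay below the exponential; conversely every
  finite product is a sum over a subset of all multisets.\<close>

theorem msets_generating_function:
  fixes r :: real
  assumes r: "0 < r" "r < 1" and summable: "summable (\<lambda>k. real (obj_count k) * r ^ k)"
  shows "((\<lambda>H. r ^ wt H) has_sum
      exp (\<Sum>i. (\<Sum>k. real (obj_count k) * (r ^ Suc i) ^ k) / real (Suc i))) {H. set_mset H \<subseteq> D}"
proof -
  define \<Lambda> where "\<Lambda> = (\<Sum>i. (\<Sum>k. real (obj_count k) * (r ^ Suc i) ^ k) / real (Suc i))"
  have logs: "((\<lambda>c. - ln (1 - r ^ w c)) has_sum \<Lambda>) D"
    unfolding \<Lambda>_def by (rule log_sum_swap[OF assms])
  have x: "0 \<le> r ^ w c" "r ^ w c < 1" if "c \<in> D" for c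
    using r w_pos[OF that] by (auto simp: power_less_one_iff)
  have fin: "((\<lambda>H. r ^ wt H) has_sum exp (\<Sum>c\<in>F. - ln (1 - r ^ w c))) {H. set_mset H \<subseteq> F}"
    if F: "finite F" "F \<subseteq> D" for F
  proof -
    have "exp (\<Sum>c\<in>F. - ln (1 - r ^ w c)) = (\<Prod>c\<in>F. 1 / (1 - r ^ w c))"
      unfolding exp_sum[OF F(1)]
    proof (intro prod.cong refl)
      fix c assume "c \<in> F"
      then show "exp (- ln (1 - r ^ w c)) = 1 / (1 - r ^ w c)"
        using x[of c] F by (auto simp: exp_minus inverse_eq_divide)
    qed
    then show ?thesis
      using geometric_msets[OF r F] by simp
  qed
  have upper: "sum (\<lambda>H. r ^ wt H) Q \<le> exp \<Lambda>" if Q: "finite Q" "Q \<subseteq> {H. set_mset H \<subseteq> D}" for Q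
  proof -
    define F where "F = (\<Union>H\<in>Q. set_mset H)"
    have F: "finite F" "F \<subseteq> D" "Q \<subseteq> {H. set_mset H \<subseteq> F}"
      using Q by (auto simp: F_def)
    have "sum (\<lambda>H. r ^ wt H) Q \<le> exp (\<Sum>c\<in>F. - ln (1 - r ^ w c))"
      using r by (intro finite_sum_le_has_sum[OF fin[OF F(1,2)] Q(1) F(3)]) auto
    also have "(\<Sum>c\<in>F. - ln (1 - r ^ w c)) \<le> \<Lambda>"
      using x by (intro finite_sum_le_has_sum[OF logs F(1,2)]) auto
    finally show ?thesis
      by simp
  qed
  have "(\<lambda>H. r ^ wt H) summable_on {H. set_mset H \<subseteq> D}"
    using r upper by (intro nonneg_bdd_above_summable_on bdd_aboveI[of _ "exp \<Lambda>"]) auto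
  then obtain S where S: "((\<lambda>H. r ^ wt H) has_sum S) {H. set_mset H \<subseteq> D}"
    using summable_on_def by blast
  have lower: "exp (\<Sum>c\<in>F. - ln (1 - r ^ w c)) \<le> S" if F: "finite F" "F \<subseteq> D" for F
    using r F by (intro has_sum_mono2[OF fin[OF F] S]) auto
  have "S > 0"
    using lower[of "{}"] by simp
  \<comment> \<open>Taking logarithms turns the bound on finite products into a bound on the finite
    partial sums of \<Lambda>.\<close>
  then have "\<Lambda> \<le> ln S"
    using lower by (intro has_sum_le_finite_sums[OF logs]) (auto simp: ln_ge_iff)
  then have "exp \<Lambda> \<le> S"
    using \<open>S > 0\<close> by (simp add: ln_ge_iff)
  moreover have "S \<le> exp \<Lambda>"
    using upper by (intro has_sum_le_finite_sums[OF S]) auto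
  ultimately show ?thesis
    using S unfolding \<Lambda>_def by simp
qed

lemma partial_sum_mset_count_le:
  fixes r :: real
  assumes r: "0 < r" and S: "((\<lambda>H. r ^ wt H) has_sum S) {H. set_mset H \<subseteq> D}"
  shows "(\<Sum>j<T. real (mset_count j) * r ^ j) \<le> S"
proof -
  have "(\<Sum>j<T. real (mset_count j) * r ^ j) = (\<Sum>j<T. \<Sum>H\<in>msets j. r ^ wt H)"
    by (intro sum.cong refl) (simp add: mset_count_def msets_def)
  also have "\<dots> = (\<Sum>H\<in>(\<Union>j<T. msets j). r ^ wt H)"
    by (intro sum.UNION_disjoint[symmetric]) (auto simp: finite_msets, auto simp: msets_def)
  also have "\<dots> \<le> S"
    using r by (intro finite_sum_le_has_sum[OF S]) (auto simp: finite_msets, auto simp: msets_def)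
  finally show ?thesis .
qed

end

section \<open>Remainders\<close>

text \<open>A strict maximum is the only candidate, so \<open>ARG_MIN\<close> ranges over a
  singleton.\<close>

lemma largest_eqI:
  assumes "c \<in># G" "\<And>d. d \<in># G \<Longrightarrow> d \<noteq> c \<Longrightarrow> sz d < sz c"
  shows "largest sz idx G = c"
proof -
  have *: "x \<in># G \<and> (\<forall>d\<in>#G. sz d \<le> sz x) \<longleftrightarrow> x = c" for x
    using assms by (metis leD less_imp_le_nat order_refl)
  show ?thesis
    unfolding largest_def * by (auto simp: arg_min_def is_arg_min_def)
qed

locale minimal_size_class =
  fixes C :: "'a set" and sz :: "'a \<Rightarrow> nat" and m :: nat
  assumes finite_size: "\<And>n. finite {c\<in>C. sz c = n}"
    and min_size: "\<And>c. c \<in> C \<Longrightarrow> m \<le> sz c"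
    and min_attained: "\<exists>c\<in>C. sz c = m"
begin

text \<open>The weight is the excess over the minimal size. It is at least 1 on heavy objects, and
  the natural subtraction is never truncated there.\<close>

sublocale weighted_class "{c\<in>C. m < sz c}" "\<lambda>c. sz c - m"
proof
  fix k
  have "{c \<in> {c\<in>C. m < sz c}. sz c - m = k} \<subseteq> {c\<in>C. sz c = k + m}"
    by auto
  then show "finite {c \<in> {c\<in>C. m < sz c}. sz c - m = k}"
    using finite_size finite_subset by blast
qed auto

section \<open>Multisets of objects of minimal size\<close>

definition light_count :: "nat \<Rightarrow> nat" where
  "light_count k = card (multisets_of_size {c\<in>C. sz c = m} k)"

lemma light_count_eq: "light_count k = (card {c\<in>C. sz c = m} + k - 1) choose k"
  unfolding light_count_def by (rule card_multisets_of_size[OF finite_size])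

lemma light_count_pos: "light_count k > 0"
  using min_attained finite_size[of m] unfolding light_count_eq
  by (auto simp: zero_less_binomial_iff card_gt_0_iff Suc_le_eq intro!: le_diff_conv2[THEN iffD2])

text \<open>With \<open>q\<close> objects of size \<open>m\<close>, the count is a polynomial of
  degree \<open>q - 1\<close> in \<open>k\<close>. The absorption identity gives the consecutive
  ratio \<open>(k + 1) / (q + k)\<close>, which tends to 1.\<close>

lemma light_count_ratio: "(\<lambda>N. real (light_count (N - j)) / real (light_count N)) \<longlonglongrightarrow> 1"
proof -
  define q where "q = card {c\<in>C. sz c = m}"
  have q: "q \<ge> 1"
    using min_attained finite_size[of m] by (auto simp: q_def Suc_le_eq card_gt_0_iff)
  have rec: "Suc k * light_count (Suc k) = (q + k) * light_count k" for k
    using binomial_absorption[of k "q + k"] by (simp add: light_count_eq q_def)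
  have "(\<lambda>k. real (Suc k) / real (q + k)) \<longlonglongrightarrow> 1"
  proof -
    have "(\<lambda>k. 1 + (1 - real q) * inverse (real (k + q))) \<longlonglongrightarrow> 1 + (1 - real q) * 0"
      by (intro tendsto_intros filterlim_compose[OF lim_inverse_n filterlim_add_const_nat_at_top])
    moreover have "1 + (1 - real q) * inverse (real (k + q)) = real (Suc k) / real (q + k)" for k
      using q by (simp add: field_simps)
    ultimately show ?thesis
      by simp
  qed
  moreover have "real (light_count k) / real (light_count (Suc k)) = real (Suc k) / real (q + k)" for k
  proof -
    have "real (Suc k) * real (light_count (Suc k)) = real (q + k) * real (light_count k)"
      using rec[of k] by (metis of_nat_mult)
    then show ?thesis
      using light_count_pos[of "Suc k"] q by (simp add: frac_eq_eq mult.commute)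
  qed
  ultimately have "(\<lambda>k. real (light_count (Suc k - 1)) / real (light_count (Suc k))) \<longlonglongrightarrow> 1"
    by simp
  then have "(\<lambda>k. real (light_count (k - 1)) / real (light_count k)) \<longlonglongrightarrow> 1"
    by (rule LIMSEQ_imp_Suc)
  then show ?thesis
    using tendsto_ratio_power[of "\<lambda>k. real (light_count k)" 1 j] light_count_pos by simp
qed

section \<open>Counting multisets and those with a given remainder\<close>

text \<open>Every component contributes \<open>m\<close>, and a heavy one its weight on top.\<close>

lemma total_size_eq:
  "set_mset G \<subseteq> C \<Longrightarrow> total_size sz G = m * size G + wt (filter_mset (\<lambda>c. sz c \<noteq> m) G)"
proof (induction G)
  case (add c G)
  then show ?case
    using min_size[of c] by (auto simp: total_size_def)
qed (simp add: total_size_def)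

text \<open>Padding the objects of size \<open>m\<close> to exactly \<open>N\<close> of them keeps a multiset recoverable from
  its heavy part.\<close>

lemma card_multisets_of_le:
  "finite (multisets_of C sz (m * N + L) N)"
  "card (multisets_of C sz (m * N + L) N) \<le> light_count N * mset_count L"
proof -
  obtain o' where o': "o' \<in> C" "sz o' = m"
    using min_attained by blast
  let ?h = "\<lambda>G. filter_mset (\<lambda>c. sz c \<noteq> m) G"
  let ?l = "\<lambda>G. filter_mset (\<lambda>c. sz c = m) G"
  let ?f = "\<lambda>G. (?l G + replicate_mset (size (?h G)) o', ?h G)"
  let ?X = "multisets_of C sz (m * N + L) N"
  let ?Y = "multisets_of_size {c\<in>C. sz c = m} N \<times> msets L"
  have part: "?l G + ?h G = G" for G
    by (rule multiset_partition[symmetric])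
  have "inj_on ?f ?X"
  proof (rule inj_onI)
    fix G G' assume "?f G = ?f G'"
    then have "?h G = ?h G'" "?l G = ?l G'"
      by auto
    then show "G = G'"
      using part by metis
  qed
  moreover have "?f ` ?X \<subseteq> ?Y"
  proof (rule image_subsetI)
    fix G assume G: "G \<in> ?X"
    then have "size (?l G) + size (?h G) = N"
      unfolding size_union[symmetric] part by (simp add: multisets_of_def)
    moreover have "wt (?h G) = L"
      using G total_size_eq[of G] by (auto simp: multisets_of_def)
    moreover have "m < sz c" if "c \<in># G" "sz c \<noteq> m" for c
      using that G min_size[of c] by (auto simp: multisets_of_def)
    ultimately show "?f G \<in> ?Y"
      using G o' by (auto simp: multisets_of_def multisets_of_size_def msets_def split: if_splits)
  qed
  moreover have "finite ?Y"
    using finite_msets finite_multisets_of_size[OF finite_size] by blast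
  ultimately show "finite ?X" "card ?X \<le> light_count N * mset_count L"
    using inj_on_finite[of ?f ?X ?Y] card_inj_on_le[of ?f ?X ?Y]
    by (auto simp: card_cartesian_product light_count_def mset_count_def)
qed

text \<open>The condition \<open>2 * wt R < L\<close> makes an object of weight
  \<open>L - wt R\<close> strictly larger than every object of \<open>R\<close>, so it is the one
  that the remainder loses. The other components are \<open>N - Suc (size R)\<close> light objects.
  The heavy and the light part of the result recover the pair.\<close>

lemma card_remainder_ge:
  assumes R: "set_mset R \<subseteq> {c\<in>C. m < sz c}" and L: "2 * wt R < L" and N: "size R < N"
  shows "obj_count (L - wt R) * light_count (N - Suc (size R))
    \<le> card {G \<in> multisets_of C sz (m * N + L) N. remainder sz idx m G = R}"
proof -
  let ?X = "{c \<in> {c\<in>C. m < sz c}. sz c - m = L - wt R} \<times> multisets_of_size {c\<in>C. sz c = m} (N - Suc (size R))"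
  let ?Y = "{G \<in> multisets_of C sz (m * N + L) N. remainder sz idx m G = R}"
  let ?f = "\<lambda>(c, F). F + add_mset c R"
  have heavy: "filter_mset (\<lambda>c. sz c \<noteq> m) R = R"
    using R by (auto simp: filter_mset_eq_conv)
  have filters: "filter_mset (\<lambda>c. sz c \<noteq> m) (?f x) = add_mset (fst x) R"
      "filter_mset (\<lambda>c. sz c = m) (?f x) = snd x" if x_in: "x \<in> ?X" for x
  proof -
    obtain c F where x: "x = (c, F)" "c \<in> C" "m < sz c" "F \<in> multisets_of_size {c\<in>C. sz c = m} (N - Suc (size R))"
      using x_in by (cases x) auto
    have "filter_mset (\<lambda>c. sz c \<noteq> m) F = {#}" "filter_mset (\<lambda>c. sz c = m) F = F"
      using x(4) by (auto simp: multisets_of_size_def filter_mset_eq_conv)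
    moreover have "filter_mset (\<lambda>c. sz c = m) R = {#}"
      using R by auto
    ultimately show "filter_mset (\<lambda>c. sz c \<noteq> m) (?f x) = add_mset (fst x) R"
        "filter_mset (\<lambda>c. sz c = m) (?f x) = snd x"
      using x heavy by auto
  qed
  have "inj_on ?f ?X"
  proof (rule inj_onI)
    fix x y assume xy: "x \<in> ?X" "y \<in> ?X" "?f x = ?f y"
    have "add_mset (fst x) R = add_mset (fst y) R"
      using filters(1)[OF xy(1)] filters(1)[OF xy(2)] unfolding xy(3) by (rule trans[OF sym])
    moreover have "snd x = snd y"
      using filters(2)[OF xy(1)] filters(2)[OF xy(2)] unfolding xy(3) by (rule trans[OF sym])
    ultimately show "x = y"
      by (simp add: prod_eq_iff)
  qed
  moreover have "?f ` ?X \<subseteq> ?Y"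
  proof (rule image_subsetI)
    fix x assume x: "x \<in> ?X"
    obtain c F where cF: "x = (c, F)"
      by (cases x)
    let ?G = "F + add_mset c R"
    have c: "c \<in> C" "m < sz c" "sz c - m = L - wt R"
      and F: "set_mset F \<subseteq> {c\<in>C. sz c = m}" "size F = N - Suc (size R)"
      using x unfolding cF by (auto simp: multisets_of_size_def)
    have sub: "set_mset ?G \<subseteq> C"
      using c F R by auto
    have h: "filter_mset (\<lambda>c. sz c \<noteq> m) ?G = add_mset c R"
      using filters(1)[OF x] by (simp add: cF)
    have sizeG: "size ?G = N"
      using F N by simp
    have "wt (add_mset c R) = L"
      using c L by simp
    then have "total_size sz ?G = m * N + L"
      using total_size_eq[OF sub] unfolding h sizeG by (simp only:)
    moreover have "largest sz idx ?G = c"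
    proof (rule largest_eqI)
      fix d assume d: "d \<in># ?G" "d \<noteq> c"
      then consider "d \<in># F" | "d \<in># R"
        by auto
      then show "sz d < sz c"
      proof cases
        case 1
        then show ?thesis
          using F c by auto
      next
        case 2
        then have "sz d - m \<le> wt R"
          by (rule w_le_wt)
        then show ?thesis
          using c L by linarith
      qed
    qed simp
    ultimately show "?f x \<in> ?Y"
      using sub sizeG h by (simp add: cF multisets_of_def remainder_def)
  qed
  moreover have "finite ?Y"
    using card_multisets_of_le(1) by simp
  ultimately have "card ?X \<le> card ?Y"
    by (rule card_inj_on_le)
  then show ?thesis
    by (simp add: card_cartesian_product obj_count_def light_count_def)
qed

text \<open>The lower bound on the favourable multisets is divided by the upper bound on all of
  them. Nonemptiness is what makes \<open>pmf_of_set\<close> the uniform distribution.\<close>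

lemma pmf_remainder_ge:
  assumes R: "set_mset R \<subseteq> {c\<in>C. m < sz c}" and L: "2 * wt R < L" and N: "size R < N"
    and nonempty: "multisets_of C sz (m * N + L) N \<noteq> {}"
  shows "real (obj_count (L - wt R) * light_count (N - Suc (size R))) / real (light_count N * mset_count L)
    \<le> pmf (map_pmf (remainder sz idx m) (pmf_of_set (multisets_of C sz (m * N + L) N))) R"
proof -
  let ?X = "multisets_of C sz (m * N + L) N"
  have fin: "finite ?X"
    by (rule card_multisets_of_le)
  have "pmf (map_pmf (remainder sz idx m) (pmf_of_set ?X)) R
      = real (card (?X \<inter> remainder sz idx m -` {R})) / real (card ?X)"
    using fin nonempty by (simp add: pmf_map measure_pmf_of_set)
  also have "?X \<inter> remainder sz idx m -` {R} = {G \<in> ?X. remainder sz idx m G = R}"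
    by auto
  also have "real (obj_count (L - wt R) * light_count (N - Suc (size R))) / real (light_count N * mset_count L)
      \<le> real (card {G \<in> ?X. remainder sz idx m G = R}) / real (card ?X)"
    using fin nonempty card_multisets_of_le(2)[of N L] card_remainder_ge[OF R L N, of idx]
    by (intro frac_le) (auto simp: card_gt_0_iff simp flip: of_nat_mult)
  finally show ?thesis .
qed

end

section \<open>The limit distribution\<close>

text \<open>Total mass 1 turns lower bounds into an upper bound: on a finite set carrying almost all
  of \<open>q\<close>, the other points already claim nearly \<open>1 - q x\<close>.\<close>

lemma pmf_tendsto_of_lower_bounds:
  fixes p :: "nat \<Rightarrow> 'b pmf" and q :: "'b \<Rightarrow> real"
  assumes q: "(q has_sum 1) A" and nonneg: "\<And>x. q x \<ge> 0"
    and lower: "\<And>x \<epsilon>. x \<in> A \<Longrightarrow> \<epsilon> > 0 \<Longrightarrow> \<forall>\<^sub>F i in sequentially. q x - \<epsilon> \<le> pmf (p i) x"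
    and x: "x \<in> A"
  shows "(\<lambda>i. pmf (p i) x) \<longlonglongrightarrow> q x"
proof (rule tendstoI)
  fix \<epsilon> :: real assume \<epsilon>: "\<epsilon> > 0"
  obtain F0 where F0: "finite F0" "F0 \<subseteq> A" "dist (sum q F0) 1 \<le> \<epsilon> / 4"
    using has_sum_finite_approximation[OF q, of "\<epsilon> / 4"] \<epsilon> by auto
  define F where "F = insert x F0"
  have F: "finite F" "F \<subseteq> A" "x \<in> F"
    using F0 x by (auto simp: F_def)
  have "sum q F0 \<le> sum q F"
    using F nonneg by (intro sum_mono2) (auto simp: F_def)
  then have q_F: "1 - \<epsilon> / 4 \<le> sum q F"
    using F0(3) unfolding dist_real_def by arith
  \<comment> \<open>One error \<delta> for each point of \<open>F\<close> adds up to
    \<open>\<epsilon> / 4\<close>.\<close>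
  define \<delta> where "\<delta> = \<epsilon> / (4 * real (card F))"
  have card: "real (card F) \<ge> 1"
    using F by (auto simp: Suc_le_eq card_gt_0_iff)
  have \<delta>: "\<delta> > 0" "real (card F) * \<delta> = \<epsilon> / 4"
    using card \<epsilon> by (auto simp: \<delta>_def)
  have "\<delta> \<le> \<epsilon> / 4"
    using mult_right_mono[OF card, of \<delta>] \<delta> by simp
  have "\<forall>\<^sub>F i in sequentially. \<forall>y\<in>F. q y - \<delta> \<le> pmf (p i) y"
    using F lower \<delta> by (intro eventually_ball_finite) auto
  then show "\<forall>\<^sub>F i in sequentially. dist (pmf (p i) x) (q x) < \<epsilon>"
  proof eventually_elim
    case (elim i)
    have "sum (pmf (p i)) F \<le> 1"
      using measure_pmf.prob_le_1[of "p i" F] by (simp add: measure_measure_pmf_finite F)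
    then have "pmf (p i) x + sum (pmf (p i)) (F - {x}) \<le> 1"
      using F by (simp add: sum.remove)
    moreover have "(\<Sum>y\<in>F - {x}. q y - \<delta>) \<le> sum (pmf (p i)) (F - {x})"
      using elim by (intro sum_mono) auto
    moreover have "(\<Sum>y\<in>F - {x}. q y - \<delta>) = sum q F - q x - real (card (F - {x})) * \<delta>"
      using F by (simp add: sum_subtractf sum.remove)
    moreover have "real (card (F - {x})) * \<delta> \<le> \<epsilon> / 4"
      unfolding \<delta>(2)[symmetric] using \<delta>(1) by (intro mult_right_mono) (auto simp: card_Diff1_le)
    ultimately have "pmf (p i) x \<le> q x + \<epsilon> / 4 + \<epsilon> / 4"
      using q_F by argo
    moreover have "q x - \<epsilon> / 4 \<le> pmf (p i) x"
      using elim F(3) \<open>\<delta> \<le> \<epsilon> / 4\<close> by fastforce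
    ultimately have "\<bar>pmf (p i) x - q x\<bar> \<le> \<epsilon> / 2"
      unfolding abs_le_iff by argo
    then show ?case
      using \<epsilon> unfolding dist_real_def by argo
  qed
qed

text \<open>The unordered sum is converted, by way of absolute summability, into the integral over
  the counting measure that constructing a \<open>pmf\<close> requires.\<close>

lemma embed_pmf_has_sum:
  fixes f :: "'b \<Rightarrow> real"
  assumes nonneg: "\<And>x. f x \<ge> 0" and sum: "(f has_sum 1) UNIV"
  shows "\<exists>p. \<forall>x. pmf p x = f x"
proof -
  have "(\<lambda>x. norm (f x)) summable_on UNIV"
    using has_sum_imp_summable[OF sum] nonneg by simp
  then have abs: "Infinite_Set_Sum.abs_summable_on f UNIV"
    using abs_summable_equivalent by blast
  have "(\<integral>\<^sup>+x. ennreal (f x) \<partial>count_space UNIV) = ennreal (infsetsum f UNIV)"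
    using abs nonneg by (intro nn_integral_conv_infsetsum) auto
  also have "infsetsum f UNIV = 1"
    using infsetsum_infsum[OF abs] infsumI[OF sum] by simp
  finally show ?thesis
    using pmf_embed_pmf[of f] nonneg by auto
qed


locale subexponential_class = minimal_size_class C sz m
  for C :: "'a set" and sz :: "'a \<Rightarrow> nat" and m :: nat +
  fixes \<rho> :: real
  assumes subexp: "subexponential (gen_series C sz) \<rho>"
begin

abbreviation coeff :: "nat \<Rightarrow> real" where
  "coeff n \<equiv> real (card {c\<in>C. sz c = n})"

lemma nth_gen_series: "fps_nth (gen_series C sz) n = coeff n"
  by (simp add: gen_series_def)

lemma coeff_0: "coeff 0 = 0"
  and rho_pos: "\<rho> > 0"
  and coeff_pos: "\<forall>\<^sub>F n in sequentially. coeff n > 0"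
  and coeff_ratio: "(\<lambda>n. coeff (n - 1) / coeff n) \<longlonglongrightarrow> \<rho>"
  and coeff_summable: "summable (\<lambda>k. coeff k * \<rho> ^ k)"
  and coeff_convolution:
    "(\<lambda>n. (\<Sum>k=1..n. coeff k * coeff (n - k)) / coeff n) \<longlonglongrightarrow> 2 * (\<Sum>k. coeff k * \<rho> ^ k)"
  using subexp unfolding subexponential_def nth_gen_series eval_fps_def by auto

text \<open>The coefficients are integers, so a positive one is at least 1, while the terms of the
  series at \<rho> tend to 0.\<close>

lemma rho_less_1: "\<rho> < 1"
proof -
  have "\<forall>\<^sub>F k in sequentially. coeff k * \<rho> ^ k < 1"
    by (rule order_tendstoD(2)[OF summable_LIMSEQ_zero[OF coeff_summable]]) simp
  then have "\<forall>\<^sub>F k in sequentially. \<rho> ^ k < 1"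
    using coeff_pos
  proof eventually_elim
    case (elim k)
    have "\<rho> ^ k \<le> coeff k * \<rho> ^ k"
      using elim rho_pos by (intro mult_le_cancel_right1[THEN iffD2]) auto
    then show ?case
      using elim by simp
  qed
  then obtain k where "\<rho> ^ k < 1"
    using eventually_happens'[OF sequentially_bot] by blast
  then show ?thesis
    using rho_pos one_le_power[of \<rho> k] by (meson not_le)
qed

section \<open>Heavy objects inherit subexponentiality\<close>

lemma obj_count_0: "obj_count 0 = 0"
  by (auto simp: obj_count_def card_eq_0_iff)

text \<open>The shift by \<open>m\<close> fails only at weight 0: objects of size \<open>m\<close>
  exist but are not heavy.\<close>

lemma obj_count_eq: "k > 0 \<Longrightarrow> real (obj_count k) = coeff (k + m)"
  unfolding obj_count_def by (intro arg_cong[of _ _ "\<lambda>A. real (card A)"]) auto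

lemma obj_count_le: "real (obj_count k) \<le> coeff (k + m)"
  using obj_count_0 obj_count_eq by (cases "k = 0") auto

lemma shift: "filterlim (\<lambda>n. n + m) sequentially sequentially"
  by (rule filterlim_add_const_nat_at_top)

lemma obj_count_pos: "\<forall>\<^sub>F k in sequentially. real (obj_count k) > 0"
  using eventually_compose_filterlim[OF coeff_pos shift] eventually_gt_at_top[of 0]
  by eventually_elim (simp only: obj_count_eq)

lemma obj_count_ratio: "(\<lambda>k. real (obj_count (k - 1)) / real (obj_count k)) \<longlonglongrightarrow> \<rho>"
proof -
  have "(\<lambda>k. coeff (k + m - 1) / coeff (k + m)) \<longlonglongrightarrow> \<rho>"
    by (rule filterlim_compose[OF coeff_ratio shift])
  moreover have "\<forall>\<^sub>F k in sequentially.
      coeff (k + m - 1) / coeff (k + m) = real (obj_count (k - 1)) / real (obj_count k)"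
    using eventually_gt_at_top[of 1] by eventually_elim (simp add: obj_count_eq)
  ultimately show ?thesis
    by (simp only: tendsto_cong)
qed

lemma coeff_summable_le:
  assumes "0 < z" "z \<le> \<rho>"
  shows "summable (\<lambda>k. coeff k * z ^ k)"
  using assms
  by (intro summable_comparison_test'[OF coeff_summable]) (auto intro!: mult_left_mono power_mono)

text \<open>Coefficients below \<open>m\<close> vanish by minimality, so removing the term at
  \<open>m\<close> and dividing by \<open>z ^ m\<close> leaves the heavy objects by weight. At
  \<open>z = \<rho> ^ j\<close> this is the quotient in the limit law, up to the factor
  \<open>1 / j\<close>.\<close>

lemma obj_count_sums:
  assumes z: "0 < z" "z \<le> \<rho>"
  shows "(\<lambda>k. real (obj_count k) * z ^ k) sums
    ((eval_fps (gen_series C sz) z - fps_nth (gen_series C sz) m * z ^ m) / z ^ m)"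
proof -
  let ?e = "\<Sum>k. coeff k * z ^ k"
  have "(\<lambda>k. coeff (k + Suc m) * z ^ (k + Suc m)) sums (?e - (\<Sum>k<Suc m. coeff k * z ^ k))"
    by (rule sums_split_initial_segment) (intro summable_sums coeff_summable_le z)
  also have "(\<Sum>k<Suc m. coeff k * z ^ k) = coeff m * z ^ m"
  proof -
    have "coeff k * z ^ k = 0" if "k < m" for k
    proof -
      have "{c\<in>C. sz c = k} = {}"
        using min_size that by fastforce
      then show ?thesis
        by (simp only:) simp
    qed
    then have "(\<Sum>k<m. coeff k * z ^ k) = 0"
      by (intro sum.neutral) blast
    then show ?thesis
      by simp
  qed
  finally have "(\<lambda>k. coeff (Suc k + m) * z ^ (Suc k + m) / z ^ m) sums ((?e - coeff m * z ^ m) / z ^ m)"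
    by (intro sums_divide) simp
  then have "(\<lambda>k. real (obj_count (Suc k)) * z ^ Suc k) sums ((?e - coeff m * z ^ m) / z ^ m)"
    using z by (simp add: obj_count_eq power_add)
  then show ?thesis
    by (subst (asm) sums_Suc_iff) (simp add: obj_count_0 eval_fps_def nth_gen_series)
qed

text \<open>Shifting both factors by \<open>m\<close> embeds the sum for \<open>n\<close> into the
  middle of the convolution of all sizes at \<open>n + 2 * m\<close>. Passing from
  \<open>coeff (n + 2 * m)\<close> back to \<open>coeff (n + m)\<close> costs a bounded
  factor.\<close>

lemma obj_count_middle:
  assumes \<epsilon>: "\<epsilon> > 0"
  shows "\<forall>\<^sub>F T in sequentially. \<forall>\<^sub>F n in sequentially.
    (\<Sum>k=T..n-T. real (obj_count k) * real (obj_count (n - k))) \<le> \<epsilon> * real (obj_count n)"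
proof -
  \<comment> \<open>Compensates the ratio of \<open>coeff (n + m)\<close> to
    \<open>coeff (n + 2 * m)\<close>, which tends to \<open>\<rho> ^ m\<close> and eventually
    exceeds half of it.\<close>
  define \<delta> where "\<delta> = \<epsilon> * \<rho> ^ m / 2"
  have "\<delta> > 0"
    using \<epsilon> rho_pos by (simp add: \<delta>_def)
  then have "\<forall>\<^sub>F T in sequentially. \<forall>\<^sub>F n in sequentially. (\<Sum>k=T..n-T. coeff k * coeff (n - k)) \<le> \<delta> * coeff n"
    by (rule convolution_middle_small[OF coeff_pos coeff_ratio coeff_0 coeff_summable coeff_convolution])
  then show ?thesis
  proof eventually_elim
    case (elim T)
    have shift2: "filterlim (\<lambda>n. n + 2 * m) sequentially sequentially"
      by (rule filterlim_add_const_nat_at_top)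
    have "(\<lambda>n. coeff (n + 2 * m - m) / coeff (n + 2 * m)) \<longlonglongrightarrow> \<rho> ^ m"
      by (rule filterlim_compose[OF tendsto_ratio_power[OF coeff_pos coeff_ratio] shift2])
    then have "\<forall>\<^sub>F n in sequentially. \<rho> ^ m / 2 < coeff (n + 2 * m - m) / coeff (n + 2 * m)"
      using rho_pos by (intro order_tendstoD(1)) auto
    then show ?case
      using eventually_compose_filterlim[OF elim shift2] eventually_gt_at_top[of 0]
        eventually_compose_filterlim[OF coeff_pos shift2]
    proof eventually_elim
      case (elim n)
      have "(\<Sum>k=T..n-T. real (obj_count k) * real (obj_count (n - k)))
          \<le> (\<Sum>k=T..n-T. coeff (k + m) * coeff (n + 2 * m - (k + m)))"
      proof (intro sum_mono mult_mono obj_count_le)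
        fix k assume "k \<in> {T..n-T}"
        then have "n + 2 * m - (k + m) = n - k + m"
          by auto
        then show "real (obj_count (n - k)) \<le> coeff (n + 2 * m - (k + m))"
          using obj_count_le[of "n - k"] by simp
      qed auto
      also have "\<dots> = (\<Sum>k=T+m..n-T+m. coeff k * coeff (n + 2 * m - k))"
        by (rule sum.shift_bounds_cl_nat_ivl[symmetric])
      also have "\<dots> \<le> (\<Sum>k=T..n+2*m-T. coeff k * coeff (n + 2 * m - k))"
      proof (cases "T \<le> n")
        case True
        then show ?thesis
          by (intro sum_mono2) auto
      next
        \<comment> \<open>Here \<open>n - T\<close> is truncated to 0, and the left-hand range is
          empty because \<open>T > n > 0\<close>.\<close>
        case False
        then show ?thesis
          by (simp add: sum_nonneg)
      qed
      also have "\<dots> \<le> \<delta> * coeff (n + 2 * m)"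
        using elim by simp
      also have "\<dots> = \<epsilon> * (\<rho> ^ m / 2 * coeff (n + 2 * m))"
        by (simp add: \<delta>_def)
      also have "\<dots> \<le> \<epsilon> * coeff (n + 2 * m - m)"
        using elim \<epsilon> by (intro mult_left_mono) (auto simp: pos_less_divide_eq)
      also have "coeff (n + 2 * m - m) = real (obj_count n)"
        unfolding obj_count_eq[OF elim(3)] by (simp add: add.commute)
      finally show ?case .
    qed
  qed
qed

section \<open>The normalizing constant and the limit law\<close>

text \<open>The generating function of heavy multisets by weight at \<rho>, in its exponential form.
  Its reciprocal is the prefactor of the limit law.\<close>

definition Z :: real where
  "Z = exp (\<Sum>i. (\<Sum>k. real (obj_count k) * (\<rho> ^ Suc i) ^ k) / real (Suc i))"

lemma Z_pos: "Z > 0"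
  by (simp add: Z_def)

lemma obj_count_summable: "summable (\<lambda>k. real (obj_count k) * \<rho> ^ k)"
  using obj_count_sums[of \<rho>] rho_pos by (auto intro: sums_summable)

lemma has_sum_Z: "((\<lambda>H. \<rho> ^ wt H) has_sum Z) {H. set_mset H \<subseteq> {c\<in>C. m < sz c}}"
  unfolding Z_def by (rule msets_generating_function[OF rho_pos rho_less_1 obj_count_summable])

sublocale euler_transform_asymptotics "\<lambda>n. real (mset_count n)" "\<lambda>n. real (obj_count n)" \<rho> Z
proof
  show "real n * real (mset_count n)
      = (\<Sum>k=1..n. (\<Sum>d | d dvd k. real d * real (obj_count d)) * real (mset_count (n - k)))" for n
    using arg_cong[OF euler_recursion[of n], of real] by simp
qed (use rho_pos rho_less_1 obj_count_pos obj_count_ratio obj_count_summable obj_count_middle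
    partial_sum_mset_count_le[OF _ has_sum_Z] in auto)

text \<open>The summands in the exponent are the heavy object series at the powers of \<rho>, and
  for a heavy multiset size minus \<open>m\<close> times the number of components is the
  weight.\<close>

lemma limit_prob_eq:
  assumes G: "set_mset G \<subseteq> {c\<in>C. m < sz c}"
  shows "limit_prob C sz \<rho> m G = \<rho> ^ wt G / Z"
proof -
  have "(let j = Suc i in (eval_fps (gen_series C sz) (\<rho> ^ j) - fps_nth (gen_series C sz) m * \<rho> ^ (j * m))
      / (real j * \<rho> ^ (j * m))) = (\<Sum>k. real (obj_count k) * (\<rho> ^ Suc i) ^ k) / real (Suc i)" for i
  proof -
    have "\<rho> ^ Suc i \<le> \<rho>"
      using rho_pos rho_less_1 power_decreasing[of 1 "Suc i" \<rho>] by simp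
    then have "(\<Sum>k. real (obj_count k) * (\<rho> ^ Suc i) ^ k) =
        (eval_fps (gen_series C sz) (\<rho> ^ Suc i) - fps_nth (gen_series C sz) m * (\<rho> ^ Suc i) ^ m) / (\<rho> ^ Suc i) ^ m"
      using rho_pos by (intro sums_unique[symmetric] obj_count_sums) auto
    then show ?thesis
      by (simp only: Let_def power_mult divide_divide_eq_left mult.commute)
  qed
  then have "limit_prob C sz \<rho> m G = \<rho> powi (int (total_size sz G) - int (m * size G)) / Z"
    unfolding limit_prob_def Z_def by (simp only: exp_minus divide_inverse mult.commute)
  also have "int (total_size sz G) - int (m * size G) = int (wt G)"
  proof -
    have "filter_mset (\<lambda>c. sz c \<noteq> m) G = G"
      using G by (auto simp: filter_mset_eq_conv)
    then show ?thesis
      using total_size_eq[of G] G by (subst total_size_eq) auto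
  qed
  finally show ?thesis
    by simp
qed

lemma multisets_above_eq: "multisets_above C sz m = {H. set_mset H \<subseteq> {c\<in>C. m < sz c}}"
  by (auto simp: multisets_above_def)

lemma limit_pmf_exists:
  "\<exists>\<Gamma>. set_pmf \<Gamma> \<subseteq> multisets_above C sz m \<and> (\<forall>G\<in>multisets_above C sz m. pmf \<Gamma> G = \<rho> ^ wt G / Z)"
proof -
  define f where "f = (\<lambda>G. if G \<in> multisets_above C sz m then \<rho> ^ wt G / Z else 0)"
  have "((\<lambda>G. \<rho> ^ wt G / Z) has_sum 1) (multisets_above C sz m)"
    using has_sum_divide_const[OF has_sum_Z, of Z] Z_pos by (simp add: multisets_above_eq)
  also have "?this \<longleftrightarrow> (f has_sum 1) UNIV"
    by (rule has_sum_cong_neutral) (auto simp: f_def)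
  finally have "(f has_sum 1) UNIV" .
  moreover have "f G \<ge> 0" for G
    using rho_pos Z_pos by (simp add: f_def)
  ultimately obtain \<Gamma> where \<Gamma>: "\<And>G. pmf \<Gamma> G = f G"
    using embed_pmf_has_sum[of f] by blast
  then show ?thesis
    by (intro exI[of _ \<Gamma>]) (auto simp: f_def set_pmf_iff split: if_splits)
qed

text \<open>In the finite lower bound the ratio of object counts tends to
  \<open>\<rho> ^ wt R\<close> and the ratio of light counts to 1, while the multiset count is
  eventually at most \<open>(Z + \<delta>)\<close> times the object count.\<close>

lemma pmf_remainder_lower_bound:
  assumes N: "filterlim N at_top sequentially"
    and L: "filterlim (\<lambda>i. int (n i) - int (m * N i)) at_top sequentially"
    and R: "R \<in> multisets_above C sz m" and \<epsilon>: "\<epsilon> > 0"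
  shows "\<forall>\<^sub>F i in sequentially. \<rho> ^ wt R / Z - \<epsilon>
    \<le> pmf (map_pmf (remainder sz idx m) (pmf_of_set (multisets_of C sz (n i) (N i)))) R"
proof -
  \<comment> \<open>The truncation by \<open>nat\<close> is eventually harmless, since the integer
    difference tends to infinity.\<close>
  define l where "l i = nat (int (n i) - int (m * N i))" for i
  have l: "filterlim l sequentially sequentially"
    unfolding l_def by (rule filterlim_compose[OF filterlim_nat_sequentially L])
  have n_eq: "\<forall>\<^sub>F i in sequentially. n i = m * N i + l i"
    using eventually_compose_filterlim[OF eventually_ge_at_top[of 0] L]
  proof eventually_elim
    case (elim i)
    then have le: "m * N i \<le> n i"
      by (simp del: of_nat_mult)
    then show ?case
      unfolding l_def of_nat_diff[OF le, symmetric] nat_int using le by simp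
  qed
  \<comment> \<open>By continuity at 0 some positive \<delta> costs less than \<epsilon> in the
    limit.\<close>
  have "((\<lambda>\<delta>. \<rho> ^ wt R / (Z + \<delta>)) \<longlongrightarrow> \<rho> ^ wt R / (Z + 0)) (at_right 0)"
    using Z_pos by (intro tendsto_intros) auto
  then have "\<forall>\<^sub>F \<delta> in at_right 0. \<rho> ^ wt R / Z - \<epsilon> < \<rho> ^ wt R / (Z + \<delta>)"
    using \<epsilon> by (intro order_tendstoD(1)) auto
  then have "\<forall>\<^sub>F \<delta> in at_right 0. \<rho> ^ wt R / Z - \<epsilon> < \<rho> ^ wt R / (Z + \<delta>) \<and> \<delta> > 0"
    using eventually_at_right_less by (rule eventually_conj)
  then obtain \<delta> where \<delta>: "\<rho> ^ wt R / Z - \<epsilon> < \<rho> ^ wt R / (Z + \<delta>)" "\<delta> > 0"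
    using eventually_happens'[of "at_right (0::real)"] by auto
  have "(\<lambda>i. real (obj_count (l i - wt R)) / real (obj_count (l i)) *
      (real (light_count (N i - Suc (size R))) / real (light_count (N i))) / (Z + \<delta>))
      \<longlonglongrightarrow> \<rho> ^ wt R * 1 / (Z + \<delta>)"
    using Z_pos \<delta>(2)
    by (intro tendsto_intros filterlim_compose[OF light_count_ratio N]
        filterlim_compose[OF tendsto_ratio_power[OF obj_count_pos obj_count_ratio] l]) auto
  then have lim: "\<forall>\<^sub>F i in sequentially. \<rho> ^ wt R / Z - \<epsilon> <
      real (obj_count (l i - wt R)) / real (obj_count (l i)) *
      (real (light_count (N i - Suc (size R))) / real (light_count (N i))) / (Z + \<delta>)"
    using \<delta>(1) by (intro order_tendstoD(1)) auto
  note l_ev = eventually_compose_filterlim[OF _ l]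
  note N_ev = eventually_compose_filterlim[OF _ N]
  show ?thesis
    using lim n_eq l_ev[OF obj_count_pos] l_ev[OF coefficient_limsup[OF \<delta>(2)]]
      l_ev[OF eventually_gt_at_top[of "2 * wt R"]] N_ev[OF eventually_gt_at_top[of "size R"]]
  proof eventually_elim
    case (elim i)
    let ?X = "multisets_of C sz (m * N i + l i) (N i)"
    \<comment> \<open>The counting bound for the empty remainder already provides a
      multiset.\<close>
    have nonempty: "?X \<noteq> {}"
    proof -
      have "obj_count (l i) * light_count (N i - 1) \<le> card {G \<in> ?X. remainder sz idx m G = {#}}"
        using elim card_remainder_ge[of "{#}" "l i" "N i" idx] by simp
      moreover have "obj_count (l i) * light_count (N i - 1) > 0"
        using elim light_count_pos by simp
      ultimately have "card {G \<in> ?X. remainder sz idx m G = {#}} > 0"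
        by linarith
      then show ?thesis
        by (auto simp: card_gt_0_iff)
    qed
    have count_pos: "real (mset_count (l i)) > 0"
    proof -
      have "card ?X > 0"
        using nonempty card_multisets_of_le(1) by (simp add: card_gt_0_iff)
      then have "light_count (N i) * mset_count (l i) > 0"
        using card_multisets_of_le(2)[of "N i" "l i"] by linarith
      then show ?thesis
        by simp
    qed
    have "\<rho> ^ wt R / Z - \<epsilon> \<le> real (obj_count (l i - wt R) * light_count (N i - Suc (size R)))
        / (real (light_count (N i)) * ((Z + \<delta>) * real (obj_count (l i))))"
      using elim(1) by (simp add: mult_ac)
    also have "\<dots> \<le> real (obj_count (l i - wt R) * light_count (N i - Suc (size R)))
        / (real (light_count (N i)) * real (mset_count (l i)))"
      using elim(3,4) count_pos light_count_pos Z_pos \<delta>(2)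
      by (intro divide_left_mono mult_left_mono mult_pos_pos add_pos_pos) auto
    also have "\<dots> = real (obj_count (l i - wt R) * light_count (N i - Suc (size R)))
        / real (light_count (N i) * mset_count (l i))"
      by simp
    also have "\<dots> \<le> pmf (map_pmf (remainder sz idx m) (pmf_of_set ?X)) R"
      using R elim nonempty by (intro pmf_remainder_ge) (auto simp: multisets_above_eq)
    finally show ?case
      using elim(2) by simp
  qed
qed

end

theorem theorem1p3:
  fixes C :: "'a set" and sz idx :: "'a \<Rightarrow> nat" and \<rho> :: real and m :: nat
  assumes "combinatorial_class C sz"
    and "inj_on idx C"
    and "subexponential (gen_series C sz) \<rho>"
    and "m = min_size C sz"
  shows "\<exists>\<Gamma> :: 'a multiset pmf.
      set_pmf \<Gamma> \<subseteq> multisets_above C sz m \<and>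
      (\<forall>G\<in>multisets_above C sz m. pmf \<Gamma> G = limit_prob C sz \<rho> m G) \<and>
      (\<forall>n N :: nat \<Rightarrow> nat.
         filterlim n at_top sequentially \<longrightarrow>
         filterlim N at_top sequentially \<longrightarrow>
         filterlim (\<lambda>i. int (n i) - int (m * N i)) at_top sequentially \<longrightarrow>
         (\<forall>G\<in>multisets_above C sz m.
            (\<lambda>i. pmf (map_pmf (remainder sz idx m) (pmf_of_set (multisets_of C sz (n i) (N i)))) G)
              \<longlonglongrightarrow> pmf \<Gamma> G))"
proof -
  have fin: "finite {c\<in>C. sz c = k}" and pos: "c \<in> C \<Longrightarrow> 1 \<le> sz c" for k c
    using assms(1) by (auto simp: combinatorial_class_def)
  have nth: "fps_nth (gen_series C sz) k > 0 \<longleftrightarrow> (\<exists>c\<in>C. sz c = k)" for k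
    using fin by (auto simp: gen_series_def card_gt_0_iff)
  have "\<forall>\<^sub>F k in sequentially. fps_nth (gen_series C sz) k > 0"
    using assms(3) by (simp add: subexponential_def)
  then have "\<forall>\<^sub>F k in sequentially. 1 \<le> k \<and> fps_nth (gen_series C sz) k > 0"
    by (intro eventually_conj eventually_ge_at_top)
  \<comment> \<open>Eventual positivity of the coefficients ensures that the minimum defining
    \<open>m\<close> is attained.\<close>
  from LeastI_ex[OF eventually_happens'[OF sequentially_bot this]]
  have "fps_nth (gen_series C sz) m > 0"
    unfolding assms(4) min_size_def by (rule conjunct2)
  then have attained: "\<exists>c\<in>C. sz c = m"
    unfolding nth .
  have "m \<le> sz c" if "c \<in> C" for c
    unfolding assms(4) min_size_def nth using that pos by (intro Least_le) auto
  then interpret subexponential_class C sz m \<rho>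
    using fin attained assms(3) by unfold_locales auto
  obtain \<Gamma> where \<Gamma>: "set_pmf \<Gamma> \<subseteq> multisets_above C sz m"
      "\<And>G. G \<in> multisets_above C sz m \<Longrightarrow> pmf \<Gamma> G = \<rho> ^ wt G / Z"
    using limit_pmf_exists by blast
  \<comment> \<open>The limiting lower bounds have total mass 1, which forces them to be the
    limits.\<close>
  have sum: "((\<lambda>G. \<rho> ^ wt G / Z) has_sum 1) (multisets_above C sz m)"
    using has_sum_divide_const[OF has_sum_Z, of Z] Z_pos by (simp add: multisets_above_eq)
  have "(\<lambda>i. pmf (map_pmf (remainder sz idx m) (pmf_of_set (multisets_of C sz (n i) (N i)))) G) \<longlonglongrightarrow> pmf \<Gamma> G"
    if "filterlim N at_top sequentially" "filterlim (\<lambda>i. int (n i) - int (m * N i)) at_top sequentially"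
      "G \<in> multisets_above C sz m" for n N G
    unfolding \<Gamma>(2)[OF that(3)]
    by (rule pmf_tendsto_of_lower_bounds[OF sum _ pmf_remainder_lower_bound[OF that(1,2)] that(3)])
       (use rho_pos Z_pos in auto)
  then show ?thesis
    using \<Gamma> limit_prob_eq by (intro exI[of _ \<Gamma>]) (auto simp: multisets_above_eq)
qed

end
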